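(* Let $c\ge 1$ and let $I=\langle\mathrm{Inc}(\mathbb{N})\cdot\prod_{i=1}^{c}\prod_{j=1}^{\mu_r}x_{i,j}^{a_{i,j}}\rangle\subset K[X]=K[x_{i,j}\mid 1\le i\le c,\ j\ge 1]$, where $\underline{a}=(a_{i,j})\in\mathbb{N}_0^{c\times\mu_r}$ is a non-zero matrix whose non-zero columns are exactly those with indices $\mu_1<\mu_2<\dots<\mu_r$. Put $b_j=\sum_{i=1}^{c}a_{i,\mu_j}$ for $j=1,\dots,r$. Then: (a) $\dim K[X]/I=c-1$, that is, $\lim_{n\to\infty}\frac{\dim K[X_n]/I_n}{n}=c-1$. (b) $\deg I=\max\{b_1,\dots,b_r\}$, that is, $\lim_{n\to\infty}\sqrt[n]{\deg I_n}=\max\{b_1,\dots,b_r\}$.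
   Context: $K$ is a field, $\mathbb{N}$ is the set of positive integers, $\mathbb{N}_0$ the set of non-negative integers, and $K[X]=K[x_{i,j}\mid 1\le i\le c,\ j\ge 1]$ is a standard graded polynomial ring. $\mathrm{Inc}(\mathbb{N})=\{\pi:\mathbb{N}\to\mathbb{N}\mid\pi(i)<\pi(i+1)\text{ for all }i\ge 1\}$ is the monoid of strictly increasing functions; it acts on $K[X]$ by $K$-algebra endomorphisms with $\pi\cdot x_{i,j}=x_{i,\pi(j)}$. For a monomial $m$, $\langle\mathrm{Inc}(\mathbb{N})\cdot m\rangle$ is the ideal of $K[X]$ generated by the orbit $\{\pi\cdot m\mid\pi\in\mathrm{Inc}(\mathbb{N})\}$. For $n\in\mathbb{N}_0$ put $K[X_n]=K[x_{i,j}\mid 1\le i\le c,\ 1\le j\le n]$ (so $K[X_0]=K$) and $I_n=I\cap K[X_n]$. For a proper homogeneous ideal $\mathfrak{a}$ of $K[X_n]$, the Hilbert series $H_{K[X_n]/\mathfrak{a}}(t)=\sum_{j\ge 0}\dim_K[K[X_n]/\mathfrak{a}]_j\,t^j$ can be written uniquely as $\frac{f(t)}{(1-t)^d}$ with $f\in\mathbb{Z}[t]$, $d\in\mathbb{N}_0$ and $f(1)\ne 0$; then $d$ is the Krull dimension $\dim K[X_n]/\mathfrak{a}$ and $\deg\mathfrak{a}:=f(1)\ge 1$ is the degree of $\mathfrak{a}$ (the zero ideal has degree one). For an $\mathrm{Inc}(\mathbb{N})$-invariant homogeneous ideal $I$, the dimension of $K[X]/I$ and the degree of $I$ are by definition $\dim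 K[X]/I=\lim_{n\to\infty}\frac{\dim K[X_n]/I_n}{n}$ and $\deg I=\lim_{n\to\infty}\sqrt[n]{\deg I_n}$. *)

theory Defs
  imports
    Complex_Main
    "HOL-Library.Poly_Mapping"
    "HOL-Library.Extended_Real"
    "HOL-Computational_Algebra.Polynomial_FPS"
    "HOL-Algebra.QuotRing"
    "HOL-Algebra.Embedded_Algebras"
begin

text \<open>
  Polynomials over a field are finitely supported maps from exponent vectors to coefficients. The
  variable with index \<open>(i, j)\<close> lies in row \<open>i\<close> and column \<open>j\<close>. Rows and columns are counted from 1;
  indices containing 0 exist in the type, but are excluded by the carriers \<open>KX\<close> and \<open>KXn\<close> below.
\<close>

type_synonym 'k pol = "((nat \<times> nat) \<Rightarrow>\<^sub>0 nat) \<Rightarrow>\<^sub>0 'k"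

definition const :: "'k::field \<Rightarrow> 'k pol"
  where "const k = Poly_Mapping.single 0 k"

definition var :: "nat \<Rightarrow> nat \<Rightarrow> 'k::field pol"
  where "var i j = Poly_Mapping.single (Poly_Mapping.single (i, j) 1) 1"

definition poly_ring :: "(nat \<times> nat) set \<Rightarrow> 'k::field pol ring"
  where "poly_ring V =
    \<lparr>carrier = {p. \<forall>m \<in> Poly_Mapping.keys p. Poly_Mapping.keys m \<subseteq> V},
     mult = (*), one = 1, zero = 0, add = (+)\<rparr>"

abbreviation KX :: "nat \<Rightarrow> 'k::field pol ring"
  where "KX c \<equiv> poly_ring ({1..c} \<times> {1..})"

abbreviation KXn :: "nat \<Rightarrow> nat \<Rightarrow> 'k::field pol ring"
  where "KXn c n \<equiv> poly_ring ({1..c} \<times> {1..n})"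

lemma poly_ring_cring: "cring (poly_ring V :: 'k::field pol ring)"
proof -
  define C where "C = {p :: 'k pol. \<forall>m \<in> Poly_Mapping.keys p. Poly_Mapping.keys m \<subseteq> V}"
  have R: "poly_ring V = \<lparr>carrier = C, mult = (*), one = 1, zero = 0, add = (+)\<rparr>"
    by (simp add: poly_ring_def C_def)
  have add: "p + q \<in> C" if "p \<in> C" "q \<in> C" for p q
    using that Poly_Mapping.keys_add[of p q] unfolding C_def by blast
  have mult: "p * q \<in> C" if "p \<in> C" "q \<in> C" for p q
    unfolding C_def
  proof (rule CollectI, rule ballI)
    fix m assume "m \<in> Poly_Mapping.keys (p * q)"
    then obtain s t where "m = s + t" "s \<in> Poly_Mapping.keys p" "t \<in> Poly_Mapping.keys q"
      using keys_mult[of p q] by blast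
    then show "Poly_Mapping.keys m \<subseteq> V"
      using Poly_Mapping.keys_add[of s t] that unfolding C_def by blast
  qed
  have zero: "0 \<in> C" and one: "1 \<in> C"
    by (simp_all add: C_def)
  have uminus: "- p \<in> C" if "p \<in> C" for p
    using that by (simp add: C_def)
  have "abelian_group (poly_ring V :: 'k pol ring)"
  proof (rule abelian_groupI)
    fix p :: "'k pol" assume "p \<in> carrier (poly_ring V)"
    then show "\<exists>q \<in> carrier (poly_ring V). q \<oplus>\<^bsub>poly_ring V\<^esub> p = \<zero>\<^bsub>poly_ring V\<^esub>"
      by (intro bexI[of _ "- p"]) (simp_all add: R uminus)
  qed (simp_all add: R add zero add.assoc add.commute)
  moreover have "comm_monoid (poly_ring V :: 'k pol ring)"
    by (rule comm_monoidI) (simp_all add: R mult one mult.assoc mult.commute)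
  ultimately show ?thesis
    by (rule cringI) (simp add: R distrib_right)
qed


text \<open>
  The monoid \<open>Inc(\<nat>)\<close>, where \<open>\<nat>\<close> denotes the positive integers. The value at 0 is unconstrained;
  it plays no role in the action on \<open>K[X]\<close>.
\<close>

definition Inc :: "(nat \<Rightarrow> nat) set"
  where "Inc = {\<pi>. \<forall>j\<ge>1. 1 \<le> \<pi> j \<and> \<pi> j < \<pi> (Suc j)}"

definition inc_act :: "(nat \<Rightarrow> nat) \<Rightarrow> 'k::field pol \<Rightarrow> 'k pol"
  where "inc_act \<pi> p = (\<Sum>m \<in> Poly_Mapping.keys p. const (Poly_Mapping.lookup p m) *
    (\<Prod>(i, j) \<in> Poly_Mapping.keys m. var i (\<pi> j) ^ Poly_Mapping.lookup m (i, j)))"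

definition orbit_ideal :: "nat \<Rightarrow> 'k::field pol \<Rightarrow> 'k pol set"
  where "orbit_ideal c m = Idl\<^bsub>KX c\<^esub> {inc_act \<pi> m | \<pi>. \<pi> \<in> Inc}"

definition trunc :: "nat \<Rightarrow> 'k::field pol set \<Rightarrow> nat \<Rightarrow> 'k pol set"
  where "trunc c I n = I \<inter> carrier (KXn c n)"


text \<open>Krull dimension: the supremum of the lengths of chains of prime ideals.\<close>

definition krull_dim :: "('a, 'm) ring_scheme \<Rightarrow> enat"
  where "krull_dim R = Sup {enat l | l. \<exists>P.
    (\<forall>i\<le>l. primeideal (P i) R) \<and> (\<forall>i<l. P i \<subset> P (Suc i))}"


definition homogeneous :: "nat \<Rightarrow> 'k::field pol \<Rightarrow> bool"
  where "homogeneous d p \<longleftrightarrow>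
    (\<forall>m \<in> Poly_Mapping.keys p. (\<Sum>v \<in> Poly_Mapping.keys m. Poly_Mapping.lookup m v) = d)"

text \<open>
  For a homogeneous ideal \<open>J\<close> of \<open>R = poly_ring V\<close>, the degree \<open>d\<close> component of \<open>R/J\<close> consists of
  the cosets of the homogeneous polynomials of degree \<open>d\<close>, and its dimension is taken over the
  image of \<open>K\<close> in \<open>R/J\<close>.
\<close>

definition hilbert_fun :: "(nat \<times> nat) set \<Rightarrow> 'k::field pol set \<Rightarrow> nat \<Rightarrow> nat"
  where "hilbert_fun V J d = (THE n. ring.dimension (poly_ring V Quot J) n
    (range (\<lambda>k. J +>\<^bsub>poly_ring V\<^esub> const k))
    {J +>\<^bsub>poly_ring V\<^esub> p | p. p \<in> carrier (poly_ring V) \<and> homogeneous d p})"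

definition hilbert_series :: "(nat \<times> nat) set \<Rightarrow> 'k::field pol set \<Rightarrow> int fps"
  where "hilbert_series V J = Abs_fps (\<lambda>d. int (hilbert_fun V J d))"

text \<open>
  The degree of \<open>J\<close> is \<open>f(1)\<close>, where \<open>f(t) / (1 - t)^d\<close> with \<open>f(1) \<noteq> 0\<close> is the unique reduced
  form of the Hilbert series.
\<close>

definition ideal_deg :: "(nat \<times> nat) set \<Rightarrow> 'k::field pol set \<Rightarrow> int"
  where "ideal_deg V J = (THE e. \<exists>f d. hilbert_series V J * (1 - fps_X) ^ d = fps_of_poly f \<and>
    poly f 1 \<noteq> 0 \<and> e = poly f 1)"

end

(* Reading a monomial as the word of its columns, I_n consists of the polynomials all of whose
   monomials contain the columns of the matrix a as a subword in the sense of the componentwise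
   order (zero columns are contained in everything and so encode the gaps). Matching this subword
   greedily gives a recursion for the Hilbert series: it is G_n / (1 - t)^(c n) with
   G_n^p = (1 - t^(b_p)) G_(n-1)^p + t^(b_p) G_(n-1)^(p-1). Since 1 - t^b = (1 - t)(1 + ... + t^(b-1)),
   G_n is (1 - t)^(n + 1 - s) times a polynomial whose value at 1 is the complete homogeneous symmetric
   polynomial of degree n + 1 - s in the s = mu_r column sums. This value is the degree of I_n; it lies
   between B^(n + 1 - s) and a polynomial in n times B^(n + 1 - s), where B is the largest column sum.

   For the dimension, I_n lies in the prime ideal generated by the variables of a row that occurs in
   the last column of a, which gives chains of length (c - 1) n. Conversely, a prime ideal containing
   I_n contains variables from all but at most s - 1 columns, and a chain of primes above at least u
   variables of a polynomial ring in N variables has length at most N - u. *)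

theory Submission
  imports Defs "HOL-Library.Product_Lexorder"
begin

text \<open>The last column of the matrix is non-zero, and this is what makes \<open>trunc\<close>
  computable: a monomial of the orbit ideal in the first n columns is then a multiple of the image
  under some \<pi> with \<open>\<pi> s \<le> n\<close>, so membership is decided by a word of length
  n. Greedy matching is chosen because a word may contain the columns of \<open>a\<close> in many
  places. With a canonical place, the avoiding words fall into two disjoint classes according to
  their last column. The exponent n + 1 - s counts unmatched columns: an avoiding word has at most s
  - 1 matched columns, and every unmatched one brings a factor 1 - t. Since \<open>krull_dim\<close>
  is defined by chains of primes and not by the pole of the Hilbert series, the dimension needs an
  argument of its own. Elements that separate the members of a chain have linearly independent power
  products modulo the first member, and up to a given degree these would outnumber the monomials in
  too few variables.\<close>

lemma carrier_poly_ring [simp]: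
    "carrier (poly_ring V) = {p. \<forall>m \<in> Poly_Mapping.keys p. Poly_Mapping.keys m \<subseteq> V}"
  and mult_poly_ring [simp]: "x \<otimes>\<^bsub>poly_ring V\<^esub> y = x * y"
  and add_poly_ring [simp]: "x \<oplus>\<^bsub>poly_ring V\<^esub> y = x + y"
  and one_poly_ring [simp]: "\<one>\<^bsub>poly_ring V\<^esub> = 1"
  and zero_poly_ring [simp]: "\<zero>\<^bsub>poly_ring V\<^esub> = 0"
  by (simp_all add: poly_ring_def)

lemma ring_poly_ring: "ring (poly_ring V :: 'k::field pol ring)"
  using poly_ring_cring cring.axioms(1) by blast

lemma a_inv_poly_ring:
  assumes "p \<in> carrier (poly_ring V :: 'k::field pol ring)"
  shows "\<ominus>\<^bsub>poly_ring V\<^esub> p = - p"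
proof -
  interpret cring "poly_ring V :: 'k pol ring" by (rule poly_ring_cring)
  show ?thesis
    using assms by (intro minus_equality) auto
qed

text \<open>Negation is multiplication by the constant -1, so closure under inverses follows from
  absorption.\<close>

lemma ideal_poly_ringI:
  fixes J :: "'k::field pol set"
  assumes sub: "J \<subseteq> carrier (poly_ring V)" and zero: "0 \<in> J"
    and add: "\<And>p q. p \<in> J \<Longrightarrow> q \<in> J \<Longrightarrow> p + q \<in> J"
    and mult: "\<And>p q. p \<in> J \<Longrightarrow> q \<in> carrier (poly_ring V) \<Longrightarrow> q * p \<in> J"
  shows "ideal J (poly_ring V)"
proof (rule idealI)
  interpret cring "poly_ring V :: 'k pol ring" by (rule poly_ring_cring)
  show "ring (poly_ring V :: 'k pol ring)" by (rule ring_axioms)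
  show "subgroup J (add_monoid (poly_ring V))"
  proof (rule subgroup.intro)
    fix x assume x: "x \<in> J"
    have "(- 1) * x \<in> J" by (rule mult[OF x]) simp
    with x sub a_inv_poly_ring[of x V]
    show "inv\<^bsub>add_monoid (poly_ring V)\<^esub> x \<in> J"
      by (auto simp: a_inv_def)
  qed (use assms in auto)
qed (use mult in \<open>auto simp: mult.commute\<close>)

lemma ideal_poly_ringD:
  fixes J :: "'k::field pol set"
  assumes J: "ideal J (poly_ring V)"
  shows "J \<subseteq> carrier (poly_ring V)" and "0 \<in> J"
    and "p \<in> J \<Longrightarrow> q \<in> J \<Longrightarrow> p + q \<in> J"
    and "p \<in> J \<Longrightarrow> q \<in> J \<Longrightarrow> p - q \<in> J"
    and "p \<in> J \<Longrightarrow> q \<in> carrier (poly_ring V) \<Longrightarrow> q * p \<in> J"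
proof -
  interpret ideal J "poly_ring V" by fact
  show sub: "J \<subseteq> carrier (poly_ring V)" by (rule a_subset)
  show "0 \<in> J" using additive_subgroup.zero_closed[OF is_additive_subgroup] by simp
  show add: "p + q \<in> J" if "p \<in> J" "q \<in> J" for p q using additive_subgroup.a_closed[OF is_additive_subgroup that] by simp
  show mult: "q * p \<in> J" if "p \<in> J" "q \<in> carrier (poly_ring V)" for p q
    using I_l_closed[OF that] by simp
  show "p - q \<in> J" if "p \<in> J" "q \<in> J"
    using add[OF that(1) mult[OF that(2), of "- 1"]] by simp
qed

lemma ideal_sum_closed:
  fixes J :: "'k::field pol set"
  assumes "ideal J (poly_ring V)" "\<And>x. x \<in> A \<Longrightarrow> f x \<in> J"
  shows "sum f A \<in> J"
  using assms(2) by (induction A rule: infinite_finite_induct)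
    (auto intro: ideal_poly_ringD(2,3)[OF assms(1)])

section \<open>Polynomials as sums of terms, and constants\<close>

lemma poly_mapping_sum_monomials:
  "p = (\<Sum>m \<in> Poly_Mapping.keys p. Poly_Mapping.single m (Poly_Mapping.lookup p m))"
proof (rule poly_mapping_eqI)
  fix k
  show "Poly_Mapping.lookup p k =
    Poly_Mapping.lookup (\<Sum>m \<in> Poly_Mapping.keys p. Poly_Mapping.single m (Poly_Mapping.lookup p m)) k"
    by (auto simp: lookup_sum lookup_single when_def in_keys_iff)
qed

lemma keys_add_nat: "Poly_Mapping.keys (m + h) = Poly_Mapping.keys m \<union> Poly_Mapping.keys h"
  for m h :: "'a \<Rightarrow>\<^sub>0 nat"
  by (auto simp: in_keys_iff lookup_add)

lemma const_add: "const (k + l) = const k + const l"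
  by (simp add: const_def single_add)

lemma const_mult: "const (k * l) = const k * const l"
  by (simp add: const_def mult_single)

lemma const_one [simp]: "const 1 = 1"
  and const_zero [simp]: "const 0 = 0"
  by (simp_all add: const_def)

lemma const_in_carrier [simp]: "const k \<in> carrier (poly_ring V)"
  by (simp add: const_def)

lemma single_eq_const_mult: "Poly_Mapping.single m k = const k * Poly_Mapping.single m 1"
  by (simp add: const_def mult_single)

lemma lookup_const_mult: "Poly_Mapping.lookup (const k * p) m = k * Poly_Mapping.lookup p m"
proof -
  have "const k * p = (\<Sum>l \<in> Poly_Mapping.keys p. Poly_Mapping.single l (k * Poly_Mapping.lookup p l))"
    by (subst (1) poly_mapping_sum_monomials[of p])
      (simp add: sum_distrib_left const_def mult_single)
  then show ?thesis
    by (auto simp: lookup_sum lookup_single when_def in_keys_iff)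
qed

section \<open>Monomial ideals\<close>

text \<open>Given by a set of exponent vectors rather than by generators, so that membership is a
  condition on each monomial separately. That the span is an ideal is the separate property
  \<open>up_closed M\<close>.\<close>

definition mono_ideal :: "(nat \<times> nat) set \<Rightarrow> ((nat \<times> nat) \<Rightarrow>\<^sub>0 nat) set \<Rightarrow> 'k::field pol set"
  where "mono_ideal V M = {p \<in> carrier (poly_ring V). Poly_Mapping.keys p \<subseteq> M}"

definition up_closed :: "('a \<Rightarrow>\<^sub>0 nat) set \<Rightarrow> bool"
  where "up_closed M \<longleftrightarrow> (\<forall>m \<in> M. \<forall>h. m + h \<in> M)"

lemma ideal_mono_ideal:
  assumes M: "up_closed M"
  shows "ideal (mono_ideal V M :: 'k::field pol set) (poly_ring V)"
proof (rule ideal_poly_ringI)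
  interpret cring "poly_ring V :: 'k pol ring" by (rule poly_ring_cring)
  fix p q :: "'k pol"
  assume p: "p \<in> mono_ideal V M"
  {
    assume q: "q \<in> mono_ideal V M"
    show "p + q \<in> mono_ideal V M"
      using p q Poly_Mapping.keys_add[of p q] a_closed[of p q]
      unfolding mono_ideal_def by auto
  }
  assume q: "q \<in> carrier (poly_ring V)"
  have "Poly_Mapping.keys (q * p) \<subseteq> M"
    using keys_mult[of q p] p M unfolding mono_ideal_def up_closed_def
    by (auto simp: subset_iff) (metis add.commute)
  then show "q * p \<in> mono_ideal V M"
    using p q m_closed[of q p] unfolding mono_ideal_def by auto
qed (auto simp: mono_ideal_def)

text \<open>The multiples of the generators form an \<open>up_closed\<close> set, which gives one
  inclusion. For the other, a monomial g + h in the variables \<open>V\<close> has its cofactor h in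
  \<open>V\<close> too, because exponents cannot cancel.\<close>

lemma genideal_monomials:
  assumes G: "\<And>g. g \<in> G \<Longrightarrow> Poly_Mapping.keys g \<subseteq> V"
  shows "Idl\<^bsub>poly_ring V\<^esub> ((\<lambda>g. Poly_Mapping.single g 1) ` G) =
    (mono_ideal V {g + h | g h. g \<in> G} :: 'k::field pol set)"
    (is "Idl\<^bsub>_\<^esub> ?S = mono_ideal V ?M")
proof
  interpret cring "poly_ring V :: 'k pol ring" by (rule poly_ring_cring)
  have "up_closed ?M"
    unfolding up_closed_def by (auto simp: add.assoc) blast
  moreover have "g \<in> ?M" if "g \<in> G" for g
    using that by (intro CollectI exI[of _ g] exI[of _ 0]) simp
  then have "?S \<subseteq> mono_ideal V ?M"
    using G unfolding mono_ideal_def by (simp add: image_subset_iff)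
  ultimately show "Idl\<^bsub>poly_ring V\<^esub> ?S \<subseteq> (mono_ideal V ?M :: 'k pol set)"
    by (intro genideal_minimal ideal_mono_ideal)
  have S: "?S \<subseteq> carrier (poly_ring V :: 'k pol ring)"
    using G by (simp add: image_subset_iff)
  have id: "ideal (Idl\<^bsub>poly_ring V\<^esub> ?S) (poly_ring V :: 'k pol ring)"
    by (rule genideal_ideal[OF S])
  show "(mono_ideal V ?M :: 'k pol set) \<subseteq> Idl\<^bsub>poly_ring V\<^esub> ?S"
  proof
    fix p :: "'k pol" assume p: "p \<in> mono_ideal V ?M"
    have "Poly_Mapping.single m (Poly_Mapping.lookup p m) \<in> Idl\<^bsub>poly_ring V\<^esub> ?S"
      if m: "m \<in> Poly_Mapping.keys p" for m
    proof -
      obtain g h where gh: "g \<in> G" "m = g + h"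
        using p m unfolding mono_ideal_def by blast
      have "Poly_Mapping.keys m \<subseteq> V"
        using p m unfolding mono_ideal_def by simp
      then have "Poly_Mapping.keys h \<subseteq> V"
        by (simp add: gh(2) keys_add_nat)
      moreover have "Poly_Mapping.single g 1 \<in> Idl\<^bsub>poly_ring V\<^esub> ?S"
        using genideal_self[OF S] gh by auto
      ultimately have "Poly_Mapping.single h (Poly_Mapping.lookup p m) * Poly_Mapping.single g 1
          \<in> Idl\<^bsub>poly_ring V\<^esub> ?S"
        by (intro ideal_poly_ringD(5)[OF id]) auto
      then show ?thesis
        by (simp add: mult_single gh add.commute)
    qed
    then have "(\<Sum>m \<in> Poly_Mapping.keys p. Poly_Mapping.single m (Poly_Mapping.lookup p m))
        \<in> Idl\<^bsub>poly_ring V\<^esub> ?S"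
      by (rule ideal_sum_closed[OF id])
    then show "p \<in> Idl\<^bsub>poly_ring V\<^esub> ?S"
      using poly_mapping_sum_monomials[of p] by simp
  qed
qed


text \<open>For polynomials, \<open>restr (- M) p\<close> is the normal form of \<open>p\<close>
  modulo \<open>mono_ideal V M\<close>. The general type allows the same operation on exponent
  vectors, where it splits a monomial by its variables.\<close>

definition restr :: "'a set \<Rightarrow> ('a \<Rightarrow>\<^sub>0 'b) \<Rightarrow> 'a \<Rightarrow>\<^sub>0 'b::comm_monoid_add"
  where "restr S p = (\<Sum>m \<in> Poly_Mapping.keys p \<inter> S. Poly_Mapping.single m (Poly_Mapping.lookup p m))"

lemma lookup_restr: "Poly_Mapping.lookup (restr S p) m = (if m \<in> S then Poly_Mapping.lookup p m else 0)"
  by (auto simp: restr_def lookup_sum lookup_single when_def in_keys_iff)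

lemma keys_restr: "Poly_Mapping.keys (restr S p) = Poly_Mapping.keys p \<inter> S"
  by (auto simp: in_keys_iff lookup_restr split: if_splits)

lemma diff_restr_mono_ideal:
  assumes "p \<in> carrier (poly_ring V)"
  shows "p - restr (- M) p \<in> mono_ideal V M"
proof -
  have "Poly_Mapping.keys (p - restr (- M) p) \<subseteq> Poly_Mapping.keys p \<inter> M"
    by (auto simp: in_keys_iff lookup_minus lookup_restr split: if_splits)
  then show ?thesis
    using assms unfolding mono_ideal_def by auto
qed

section \<open>The Hilbert function of a monomial ideal\<close>

definition mdeg :: "('a \<Rightarrow>\<^sub>0 nat) \<Rightarrow> nat"
  where "mdeg m = (\<Sum>v \<in> Poly_Mapping.keys m. Poly_Mapping.lookup m v)"

lemma mdeg_eq_sum: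
  assumes "finite V" "Poly_Mapping.keys m \<subseteq> V"
  shows "mdeg m = (\<Sum>v \<in> V. Poly_Mapping.lookup m v)"
  unfolding mdeg_def using assms by (intro sum.mono_neutral_left) (auto simp: in_keys_iff)

lemma mdeg_add: "mdeg (m + h) = mdeg m + mdeg h"
proof -
  let ?V = "Poly_Mapping.keys m \<union> Poly_Mapping.keys h"
  have "mdeg (m + h) = (\<Sum>v \<in> ?V. Poly_Mapping.lookup (m + h) v)"
    by (intro mdeg_eq_sum) (auto simp: keys_add_nat)
  also have "\<dots> = mdeg m + mdeg h"
    by (subst (1 2) mdeg_eq_sum[of ?V]) (auto simp: lookup_add sum.distrib)
  finally show ?thesis .
qed

lemma mdeg_single [simp]: "mdeg (Poly_Mapping.single v e) = e"
  by (simp add: mdeg_def)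

lemma mdeg_zero [simp]: "mdeg 0 = 0"
  by (simp add: mdeg_def)

lemma lookup_le_mdeg: "Poly_Mapping.lookup m v \<le> mdeg m"
proof (cases "v \<in> Poly_Mapping.keys m")
  case True
  then show ?thesis
    unfolding mdeg_def by (intro member_le_sum) auto
qed (simp add: in_keys_iff)

text \<open>A monomial is determined by its exponents on \<open>V\<close>, so it corresponds to a
  point of a box. This crude count serves both the finiteness of the degree parts and the later
  bound on chains of primes.\<close>

lemma card_bounded_monomials:
  fixes V :: "'a set"
  assumes V: "finite V"
  defines "S \<equiv> \<lambda>s::nat. {m :: 'a \<Rightarrow>\<^sub>0 nat. Poly_Mapping.keys m \<subseteq> V \<and> (\<forall>v. Poly_Mapping.lookup m v \<le> s)}"
  shows "finite (S s)" and "card (S s) \<le> (s + 1) ^ card V"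
proof -
  let ?f = "\<lambda>m :: 'a \<Rightarrow>\<^sub>0 nat. restrict (Poly_Mapping.lookup m) V"
  have inj: "inj_on ?f (S s)"
  proof (rule inj_onI)
    fix m h assume mh: "m \<in> S s" "h \<in> S s" "?f m = ?f h"
    show "m = h"
    proof (rule poly_mapping_eqI)
      fix v
      show "Poly_Mapping.lookup m v = Poly_Mapping.lookup h v"
      proof (cases "v \<in> V")
        case True
        then show ?thesis using fun_cong[OF mh(3), of v] by simp
      next
        case False
        then have "v \<notin> Poly_Mapping.keys m" "v \<notin> Poly_Mapping.keys h"
          using mh(1,2) by (auto simp: S_def)
        then show ?thesis by (simp add: in_keys_iff)
      qed
    qed
  qed
  have sub: "?f ` S s \<subseteq> (V \<rightarrow>\<^sub>E {..s})"
    by (auto simp: S_def)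
  have fin: "finite (V \<rightarrow>\<^sub>E {..s})"
    using V by (simp add: finite_PiE)
  show "finite (S s)"
    using inj sub fin by (metis finite_imageD finite_subset)
  have "card (S s) \<le> card (V \<rightarrow>\<^sub>E {..s})"
    using card_inj_on_le[OF inj sub fin] .
  then show "card (S s) \<le> (s + 1) ^ card V"
    using V by (simp add: card_PiE)
qed

lemma finite_monomials_of_degree:
  assumes "finite V"
  shows "finite {m :: 'a \<Rightarrow>\<^sub>0 nat. Poly_Mapping.keys m \<subseteq> V \<and> mdeg m = d}"
  by (rule finite_subset[OF _ card_bounded_monomials(1)[OF assms, of d]])
    (use lookup_le_mdeg in auto)

lemma coset_eq_iff:
  fixes J :: "'k::field pol set"
  assumes J: "ideal J (poly_ring V)" and "p \<in> carrier (poly_ring V)" "q \<in> carrier (poly_ring V)"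
  shows "J +>\<^bsub>poly_ring V\<^esub> p = J +>\<^bsub>poly_ring V\<^esub> q \<longleftrightarrow> p - q \<in> J"
proof -
  interpret ring "poly_ring V :: 'k pol ring" by (rule ring_poly_ring)
  show ?thesis
    using quotient_eq_iff_same_a_r_cos[OF assms] a_inv_poly_ring[OF assms(3)]
    by (simp add: a_minus_def)
qed

text \<open>Uniqueness of \<open>ring.dimension\<close> is used over a subfield. The image of
  \<open>K\<close> in a quotient is recognized as one by transport from here.\<close>

lemma subfield_const: "subfield (range const) (poly_ring V :: 'k::field pol ring)"
proof -
  interpret cring "poly_ring V :: 'k pol ring" by (rule poly_ring_cring)
  have inv: "\<ominus>\<^bsub>poly_ring V\<^esub> (const k :: 'k pol) = const (- k)" for k
    by (subst a_inv_poly_ring[OF const_in_carrier]) (simp add: const_def single_uminus)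
  have sub: "subcring (range const) (poly_ring V :: 'k pol ring)"
  proof (rule subcringI)
    show "subring (range const) (poly_ring V :: 'k pol ring)"
    proof (rule ring.subringI[OF ring_poly_ring])
      show "range const \<subseteq> carrier (poly_ring V :: 'k pol ring)"
        using const_in_carrier by blast
      show "\<one>\<^bsub>poly_ring V\<^esub> \<in> range (const :: 'k \<Rightarrow> _)"
        by (metis const_one one_poly_ring rangeI)
    qed (auto simp: inv const_add[symmetric] const_mult[symmetric])
  qed (auto simp: mult.commute)
  show ?thesis
  proof (rule subfieldI[OF sub])
    show "Units (poly_ring V\<lparr>carrier := range (const :: 'k \<Rightarrow> _)\<rparr>) = range const - {\<zero>\<^bsub>poly_ring V\<^esub>}"
    proof (intro equalityI subsetI)
      fix x :: "'k pol" assume "x \<in> range const - {\<zero>\<^bsub>poly_ring V\<^esub>}"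
      then obtain k where x: "x = const k" "x \<noteq> 0" by auto
      then have k: "x = const k" "k \<noteq> 0" by auto
      have "const k * const (inverse k) = 1" "const (inverse k) * const k = 1"
        using k by (simp_all flip: const_mult)
      then show "x \<in> Units (poly_ring V\<lparr>carrier := range (const :: 'k \<Rightarrow> _)\<rparr>)"
        using k unfolding Units_def by (auto intro!: exI[of _ "inverse k"])
    next
      fix x :: "'k pol" assume "x \<in> Units (poly_ring V\<lparr>carrier := range (const :: 'k \<Rightarrow> _)\<rparr>)"
      then show "x \<in> range const - {\<zero>\<^bsub>poly_ring V\<^esub>}"
        unfolding Units_def by auto
    qed
  qed
qed

context
  fixes V :: "(nat \<times> nat) set" and M :: "((nat \<times> nat) \<Rightarrow>\<^sub>0 nat) set"
    and J :: "'k::field pol set"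
  assumes M: "up_closed M" "0 \<notin> M"
  defines "J \<equiv> mono_ideal V M"
begin

interpretation R: cring "poly_ring V :: 'k pol ring"
  by (rule poly_ring_cring)

lemma J_ideal: "ideal J (poly_ring V)"
  unfolding J_def by (rule ideal_mono_ideal[OF M(1)])

interpretation J: ideal J "poly_ring V"
  by (rule J_ideal)

interpretation hom: ring_hom_ring "poly_ring V :: 'k pol ring" "poly_ring V Quot J" "(+>\<^bsub>poly_ring V\<^esub>) J"
  by (rule J.rcos_ring_hom_ring)

text \<open>\<open>0 \<notin> M\<close> says that the polynomial 1 is not in \<open>J\<close>. The
  quotient is therefore non-zero, and a homomorphism into it maps a field to a field.\<close>

lemma subfield_quot: "subfield (range (\<lambda>k. J +>\<^bsub>poly_ring V\<^esub> const k)) (poly_ring V Quot J)"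
proof -
  have "J +>\<^bsub>poly_ring V\<^esub> 1 \<noteq> J +>\<^bsub>poly_ring V\<^esub> 0"
    using M(2) by (subst coset_eq_iff[OF J_ideal]) (auto simp: J_def mono_ideal_def)
  then have "\<one>\<^bsub>poly_ring V Quot J\<^esub> \<noteq> \<zero>\<^bsub>poly_ring V Quot J\<^esub>"
    using hom.hom_one hom.hom_zero by simp
  from hom.img_is_subfield(2)[OF subfield_const this] show ?thesis
    by (simp add: image_image)
qed

text \<open>Each new monomial \<open>m\<close> extends the span by a line: if its coset were that of
  some p supported on \<open>S\<close>, the difference would lie in \<open>J\<close> and have
  coefficient 1 at \<open>m\<close>, so that \<open>m\<close> would belong to
  \<open>M\<close>.\<close>

lemma dimension_cosets:
  assumes "finite S" "\<And>m. m \<in> S \<Longrightarrow> Poly_Mapping.keys m \<subseteq> V" "S \<inter> M = {}"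
  shows "ring.dimension (poly_ring V Quot J) (card S) (range (\<lambda>k. J +>\<^bsub>poly_ring V\<^esub> const k))
    {J +>\<^bsub>poly_ring V\<^esub> p | p. Poly_Mapping.keys p \<subseteq> S}"
  using assms
proof (induction S rule: finite_induct)
  case empty
  show ?case
    using hom.S.dimension.zero_dim hom.hom_zero by simp
next
  case (insert m S)
  let ?c = "\<lambda>p. J +>\<^bsub>poly_ring V\<^esub> p"
  let ?E = "{?c p | p. Poly_Mapping.keys p \<subseteq> S}"
  let ?m = "Poly_Mapping.single m 1 :: 'k pol"
  have carrS: "p \<in> carrier (poly_ring V)" if "Poly_Mapping.keys p \<subseteq> S" for p :: "'k pol"
    using that insert.prems(1) by (auto simp del: subset_iff)
  have m: "?m \<in> carrier (poly_ring V)"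
    using insert.prems(1)[of m] by simp
  have notin: "?c ?m \<notin> ?E"
  proof
    assume "?c ?m \<in> ?E"
    then obtain p where p: "Poly_Mapping.keys p \<subseteq> S" "?c ?m = ?c p" by blast
    then have "?m - p \<in> J"
      using coset_eq_iff[OF J_ideal m carrS[OF p(1)]] by simp
    moreover have "m \<notin> Poly_Mapping.keys p"
      using p(1) insert.hyps(2) by blast
    then have "Poly_Mapping.lookup (?m - p) m \<noteq> 0"
      by (simp add: lookup_minus in_keys_iff)
    ultimately show False
      using insert.prems(2) by (auto simp: J_def mono_ideal_def in_keys_iff)
  qed
  have line: "hom.S.line_extension (range (\<lambda>k. ?c (const k))) (?c ?m) ?E =
      {?c p | p. Poly_Mapping.keys p \<subseteq> insert m S}"
  proof (intro equalityI subsetI)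
    fix u assume "u \<in> hom.S.line_extension (range (\<lambda>k. ?c (const k))) (?c ?m) ?E"
    then obtain k p where kp: "Poly_Mapping.keys p \<subseteq> S"
      "u = ?c (const k) \<otimes>\<^bsub>poly_ring V Quot J\<^esub> ?c ?m \<oplus>\<^bsub>poly_ring V Quot J\<^esub> ?c p"
      unfolding hom.S.line_extension_mem_iff by blast
    have "u = ?c (const k * ?m + p)"
      using hom.hom_add[OF R.m_closed[OF const_in_carrier m] carrS[OF kp(1)], of k]
        hom.hom_mult[OF const_in_carrier m, of k] kp(2) by simp
    moreover have "Poly_Mapping.keys (const k * ?m + p) \<subseteq> insert m S"
      using Poly_Mapping.keys_add[of "const k * ?m" p] kp(1)
      by (auto simp: const_def mult_single split: if_splits)
    ultimately show "u \<in> {?c p | p. Poly_Mapping.keys p \<subseteq> insert m S}" by blast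
  next
    fix u assume "u \<in> {?c p | p. Poly_Mapping.keys p \<subseteq> insert m S}"
    then obtain p where p: "Poly_Mapping.keys p \<subseteq> insert m S" "u = ?c p" by blast
    define k where "k = Poly_Mapping.lookup p m"
    define q where "q = restr S p"
    have q: "Poly_Mapping.keys q \<subseteq> S" by (simp add: q_def keys_restr)
    have pq: "p = const k * ?m + q"
    proof (rule poly_mapping_eqI)
      fix l
      show "Poly_Mapping.lookup p l = Poly_Mapping.lookup (const k * ?m + q) l"
        using p(1) insert.hyps(2)
        by (auto simp: lookup_add lookup_const_mult lookup_restr q_def k_def lookup_single when_def in_keys_iff)
    qed
    have "u = ?c (const k) \<otimes>\<^bsub>poly_ring V Quot J\<^esub> ?c ?m \<oplus>\<^bsub>poly_ring V Quot J\<^esub> ?c q"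
      using hom.hom_add[OF R.m_closed[OF const_in_carrier m] carrS[OF q], of k]
        hom.hom_mult[OF const_in_carrier m, of k] p(2) pq by simp
    then show "u \<in> hom.S.line_extension (range (\<lambda>k. ?c (const k))) (?c ?m) ?E"
      unfolding hom.S.line_extension_mem_iff using q by blast
  qed
  have "hom.S.dimension (card S) (range (\<lambda>k. ?c (const k))) ?E"
    using insert by simp
  from hom.S.dimension.Suc_dim[OF hom.hom_closed[OF m] notin this]
  show ?case
    unfolding line using insert.hyps by simp
qed

text \<open>Deleting the monomials in \<open>M\<close> does not change a coset, so the degree d
  component is spanned by the cosets of the monomials counted here.\<close>

lemma hilbert_fun_mono_ideal:
  assumes V: "finite V"
  shows "hilbert_fun V J d = card {m. Poly_Mapping.keys m \<subseteq> V \<and> m \<notin> M \<and> mdeg m = d}"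
proof -
  let ?c = "\<lambda>p. J +>\<^bsub>poly_ring V\<^esub> p"
  define S where "S = {m. Poly_Mapping.keys m \<subseteq> V \<and> m \<notin> M \<and> mdeg m = d}"
  have fin: "finite S"
    by (rule finite_subset[OF _ finite_monomials_of_degree[OF V, of d]]) (auto simp: S_def)
  have S: "S \<inter> M = {}" "\<And>m. m \<in> S \<Longrightarrow> Poly_Mapping.keys m \<subseteq> V"
    by (auto simp: S_def)
  have "{?c p | p. p \<in> carrier (poly_ring V) \<and> homogeneous d p} = {?c p | p. Poly_Mapping.keys p \<subseteq> S}"
  proof (intro equalityI subsetI)
    fix u assume "u \<in> {?c p | p. p \<in> carrier (poly_ring V) \<and> homogeneous d p}"
    then obtain p where p: "p \<in> carrier (poly_ring V)" "homogeneous d p" "u = ?c p" by blast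
    let ?q = "restr (- M) p"
    have "Poly_Mapping.keys ?q \<subseteq> S"
      using p(1,2) by (auto simp: keys_restr S_def homogeneous_def mdeg_def)
    moreover have "?q \<in> carrier (poly_ring V)"
      using p(1) by (simp add: keys_restr)
    then have "u = ?c ?q"
      using coset_eq_iff[OF J_ideal p(1)] diff_restr_mono_ideal[OF p(1)] p(3) by (simp add: J_def)
    ultimately show "u \<in> {?c p | p. Poly_Mapping.keys p \<subseteq> S}" by blast
  next
    fix u assume "u \<in> {?c p | p. Poly_Mapping.keys p \<subseteq> S}"
    then obtain p where p: "Poly_Mapping.keys p \<subseteq> S" "u = ?c p" by blast
    then have "p \<in> carrier (poly_ring V)" "homogeneous d p"
      by (auto simp: S_def homogeneous_def mdeg_def subset_iff)
    then show "u \<in> {?c p | p. p \<in> carrier (poly_ring V) \<and> homogeneous d p}"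
      using p(2) by blast
  qed
  then have "hom.S.dimension (card S) (range (\<lambda>k. ?c (const k)))
      {?c p | p. p \<in> carrier (poly_ring V) \<and> homogeneous d p}"
    using dimension_cosets[OF fin S(2,1)] by simp
  then show ?thesis
    unfolding hilbert_fun_def S_def[symmetric]
    by (intro the_equality) (auto dest: hom.S.dimension_is_inj[OF subfield_quot])
qed

end

section \<open>Generating functions of sets of monomials\<close>

text \<open>A degree with infinitely many members would get the coefficient 0, whence the finite
  sets of variables in the sum and product rules.\<close>

definition gf :: "('a \<Rightarrow>\<^sub>0 nat) set \<Rightarrow> int fps"
  where "gf S = Abs_fps (\<lambda>d. int (card {m \<in> S. mdeg m = d}))"

definition monomials :: "'a set \<Rightarrow> ('a \<Rightarrow>\<^sub>0 nat) set"
  where "monomials V = {m. Poly_Mapping.keys m \<subseteq> V}"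

lemma finite_degree_part:
  assumes "finite V" "S \<subseteq> monomials V"
  shows "finite {m \<in> S. mdeg m = d}"
  by (rule finite_subset[OF _ finite_monomials_of_degree[OF assms(1), of d]])
    (use assms(2) in \<open>auto simp: monomials_def\<close>)

lemma gf_Un_disjoint:
  assumes "finite V" "S \<subseteq> monomials V" "T \<subseteq> monomials V" "S \<inter> T = {}"
  shows "gf (S \<union> T) = gf S + gf T"
proof (rule fps_ext)
  fix d
  have "{m \<in> S \<union> T. mdeg m = d} = {m \<in> S. mdeg m = d} \<union> {m \<in> T. mdeg m = d}"
    by auto
  moreover have "card ({m \<in> S. mdeg m = d} \<union> {m \<in> T. mdeg m = d}) =
      card {m \<in> S. mdeg m = d} + card {m \<in> T. mdeg m = d}"
    using finite_degree_part[OF assms(1,2)] finite_degree_part[OF assms(1,3)] assms(4)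
    by (intro card_Un_disjoint) auto
  ultimately show "fps_nth (gf (S \<union> T)) d = fps_nth (gf S + gf T) d"
    by (simp add: gf_def)
qed

lemma add_eq_disjoint_keys:
  fixes m m' h h' :: "'a \<Rightarrow>\<^sub>0 nat"
  assumes "m \<in> monomials V" "m' \<in> monomials V" "h \<in> monomials W" "h' \<in> monomials W"
    and "V \<inter> W = {}" "m + h = m' + h'"
  shows "m = m' \<and> h = h'"
proof -
  have eq: "Poly_Mapping.lookup m v + Poly_Mapping.lookup h v =
      Poly_Mapping.lookup m' v + Poly_Mapping.lookup h' v" for v
    using assms(6) by (metis lookup_add)
  have "Poly_Mapping.lookup m v = Poly_Mapping.lookup m' v" for v
  proof (cases "v \<in> V")
    case True
    then have "v \<notin> Poly_Mapping.keys h" "v \<notin> Poly_Mapping.keys h'"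
      using assms by (auto simp: monomials_def)
    with eq[of v] show ?thesis by (simp add: in_keys_iff)
  next
    case False
    then have "v \<notin> Poly_Mapping.keys m" "v \<notin> Poly_Mapping.keys m'"
      using assms by (auto simp: monomials_def)
    then show ?thesis by (simp add: in_keys_iff)
  qed
  then have "m = m'" by (rule poly_mapping_eqI)
  with assms(6) show ?thesis by simp
qed

text \<open>Over disjoint sets of variables a monomial determines its two parts, so the Cauchy
  product counts every monomial once.\<close>

lemma gf_sum_disjoint_keys:
  fixes V W :: "'a set"
  assumes V: "finite V" "S \<subseteq> monomials V" and W: "finite W" "T \<subseteq> monomials W"
    and VW: "V \<inter> W = {}"
  shows "gf {m + h | m h. m \<in> S \<and> h \<in> T} = gf S * gf T"
proof (rule fps_ext)
  fix d
  let ?S = "\<lambda>i. {m \<in> S. mdeg m = i}" and ?T = "\<lambda>i. {h \<in> T. mdeg h = i}"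
  have "{u \<in> {m + h | m h. m \<in> S \<and> h \<in> T}. mdeg u = d} =
      (\<Union>i\<in>{0..d}. (\<lambda>(m, h). m + h) ` (?S i \<times> ?T (d - i)))"
    by (fastforce simp: mdeg_add)
  also have "card \<dots> = (\<Sum>i=0..d. card ((\<lambda>(m, h). m + h) ` (?S i \<times> ?T (d - i))))"
  proof (rule card_UN_disjoint)
    show "\<forall>i\<in>{0..d}. finite ((\<lambda>(m, h). m + h) ` (?S i \<times> ?T (d - i)))"
      using finite_degree_part[OF V] finite_degree_part[OF W] by blast
    show "\<forall>i\<in>{0..d}. \<forall>j\<in>{0..d}. i \<noteq> j \<longrightarrow>
      (\<lambda>(m, h). m + h) ` (?S i \<times> ?T (d - i)) \<inter> (\<lambda>(m, h). m + h) ` (?S j \<times> ?T (d - j)) = {}"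
    proof (intro ballI impI, rule ccontr)
      fix i j assume ij: "i \<noteq> j"
        "(\<lambda>(m, h). m + h) ` (?S i \<times> ?T (d - i)) \<inter> (\<lambda>(m, h). m + h) ` (?S j \<times> ?T (d - j)) \<noteq> {}"
      then obtain m h m' h' where mh: "m \<in> ?S i" "h \<in> ?T (d - i)" "m' \<in> ?S j" "h' \<in> ?T (d - j)"
        "m + h = m' + h'"
        by auto
      then have "m = m'"
        using add_eq_disjoint_keys[of m V m' h W h'] V(2) W(2) VW by blast
      with mh ij show False by auto
    qed
  qed simp
  also have "\<dots> = (\<Sum>i=0..d. card (?S i) * card (?T (d - i)))"
  proof (rule sum.cong)
    fix i
    have "inj_on (\<lambda>(m, h). m + h) (?S i \<times> ?T (d - i))"
    proof (rule inj_onI, clarify)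
      fix m h m' h' assume "m \<in> S" "h \<in> T" "m' \<in> S" "h' \<in> T" "m + h = m' + h'"
      then show "m = m' \<and> h = h'"
        using add_eq_disjoint_keys[of m V m' h W h'] V(2) W(2) VW by blast
    qed
    then show "card ((\<lambda>(m, h). m + h) ` (?S i \<times> ?T (d - i))) = card (?S i) * card (?T (d - i))"
      by (simp add: card_image card_cartesian_product)
  qed simp
  finally show "fps_nth (gf {m + h | m h. m \<in> S \<and> h \<in> T}) d = fps_nth (gf S * gf T) d"
    by (simp add: gf_def fps_mult_nth)
qed

lemma gf_shift: "gf ((\<lambda>m. u + m) ` S) = fps_X ^ mdeg u * gf S"
proof (rule fps_ext)
  fix d
  have *: "{m \<in> (\<lambda>m. u + m) ` S. mdeg m = d} =
      (if d < mdeg u then {} else (\<lambda>m. u + m) ` {m \<in> S. mdeg m = d - mdeg u})"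
    by (auto simp: mdeg_add)
  show "fps_nth (gf ((\<lambda>m. u + m) ` S)) d = fps_nth (fps_X ^ mdeg u * gf S) d"
    by (simp add: gf_def * fps_X_power_mult_nth card_image)
qed

text \<open>Every variable contributes a geometric series: a monomial splits into the power of the
  new variable and a monomial in the others.\<close>

lemma gf_monomials:
  fixes V :: "'a set"
  assumes "finite V"
  shows "gf (monomials V) * (1 - fps_X) ^ card V = 1"
  using assms
proof (induction V rule: finite_induct)
  case empty
  have "{m \<in> monomials ({} :: 'a set). mdeg m = d} = (if d = 0 then {0} else {})" for d
    by (auto simp: monomials_def)
  then show ?case
    by (simp add: gf_def fps_eq_iff)
next
  case (insert v V)
  have v: "gf (monomials {v}) * (1 - fps_X) = 1"
  proof -
    have "m = Poly_Mapping.single v (mdeg m)" if "m \<in> monomials {v}" for m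
    proof (rule poly_mapping_eqI)
      fix w
      show "Poly_Mapping.lookup m w = Poly_Mapping.lookup (Poly_Mapping.single v (mdeg m)) w"
        using that mdeg_eq_sum[of "{v}" m]
        by (cases "w = v") (auto simp: monomials_def lookup_single when_def in_keys_iff)
    qed
    then have "{m \<in> monomials {v}. mdeg m = d} = {Poly_Mapping.single v d}" for d
      by (auto simp: monomials_def split: if_splits)
    then have "gf (monomials {v}) = Abs_fps (\<lambda>_. 1)"
      by (simp add: gf_def)
    moreover have "Abs_fps (\<lambda>_. 1 :: int) * (1 - fps_X) = 1"
    proof (rule fps_ext)
      fix n
      show "fps_nth (Abs_fps (\<lambda>_. 1 :: int) * (1 - fps_X)) n = fps_nth 1 n"
        by (cases n) (simp_all add: right_diff_distrib)
    qed
    ultimately show ?thesis by simp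
  qed
  have "monomials (insert v V) = {m + h | m h. m \<in> monomials {v} \<and> h \<in> monomials V}"
  proof (intro equalityI subsetI)
    fix m assume m: "m \<in> monomials (insert v V)"
    have "m = restr {v} m + restr (- {v}) m"
      by (rule poly_mapping_eqI) (simp add: lookup_add lookup_restr)
    moreover have "restr {v} m \<in> monomials {v}" "restr (- {v}) m \<in> monomials V"
      using m by (auto simp: monomials_def keys_restr)
    ultimately show "m \<in> {m + h | m h. m \<in> monomials {v} \<and> h \<in> monomials V}" by blast
  qed (auto simp: monomials_def keys_add_nat)
  then have "gf (monomials (insert v V)) = gf (monomials {v}) * gf (monomials V)"
    using insert.hyps by (simp add: gf_sum_disjoint_keys[of "{v}" _ V])
  then have "gf (monomials (insert v V)) * (1 - fps_X) ^ card (insert v V) =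
      (gf (monomials {v}) * (1 - fps_X)) * (gf (monomials V) * (1 - fps_X) ^ card V)"
    using insert.hyps by (simp add: mult_ac)
  then show ?case
    by (simp only: v insert.IH mult_1)
qed


section \<open>Column words avoiding a subword\<close>

text \<open>A monomial is read as the word of its columns. Columns are matched greedily from the right,
  and a zero column of \<open>a\<close> is matched by every column.\<close>

fun emb :: "nat \<Rightarrow> (nat \<Rightarrow> nat \<Rightarrow> nat) \<Rightarrow> nat \<Rightarrow> nat \<Rightarrow> ((nat \<times> nat) \<Rightarrow>\<^sub>0 nat) \<Rightarrow> bool"
  where
    "emb c a 0 n m = True"
  | "emb c a (Suc p) 0 m = False"
  | "emb c a (Suc p) (Suc n) m =
      (if \<forall>i\<in>{1..c}. a i (Suc p) \<le> Poly_Mapping.lookup m (i, Suc n)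
       then emb c a p n m else emb c a (Suc p) n m)"

lemma Inc_less: "\<pi> \<in> Inc \<Longrightarrow> 1 \<le> i \<Longrightarrow> i < j \<Longrightarrow> \<pi> i < \<pi> j"
proof (induction j)
  case (Suc j)
  then have "\<pi> j < \<pi> (Suc j)" by (auto simp: Inc_def)
  with Suc show ?case by (cases "i = j") auto
qed simp

text \<open>Greedy matching loses nothing. If column \<open>Suc n\<close> fits the last letter, any
  embedding may be changed to send that letter to \<open>Suc n\<close>, as all earlier letters are
  placed strictly before. If it does not fit, the last letter goes to an earlier column, and so do
  all others.\<close>

lemma emb_iff:
  "emb c a p n m \<longleftrightarrow> (\<exists>\<pi>\<in>Inc. \<forall>j\<in>{1..p}. \<pi> j \<le> n \<and>
    (\<forall>i\<in>{1..c}. a i j \<le> Poly_Mapping.lookup m (i, \<pi> j)))"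
proof (induction c a p n m rule: emb.induct)
  case (1 c a n m)
  have "id \<in> Inc" by (simp add: Inc_def)
  then show ?case unfolding emb.simps by (intro iffI TrueI bexI[of _ id]) simp_all
next
  case (2 c a p m)
  have "\<not> (\<forall>j\<in>{1..Suc p}. \<pi> j \<le> 0 \<and> Q j (\<pi> j))" if "\<pi> \<in> Inc" for \<pi> Q
  proof
    assume "\<forall>j\<in>{1..Suc p}. \<pi> j \<le> 0 \<and> Q j (\<pi> j)"
    then have "\<pi> (Suc p) \<le> 0" by (elim ballE[of _ _ "Suc p"]) simp_all
    moreover have "1 \<le> \<pi> (Suc p)"
      using that unfolding Inc_def by simp
    ultimately show False by simp
  qed
  then show ?case unfolding emb.simps by blast
next
  case (3 c a p n m)
  let ?fits = "\<lambda>j k. \<forall>i\<in>{1..c}. a i j \<le> Poly_Mapping.lookup m (i, k)"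
  have below: "\<pi> j < \<pi> (Suc p)" if "\<pi> \<in> Inc" "j \<in> {1..p}" for \<pi> j
    using Inc_less[of \<pi> j "Suc p"] that by auto
  show ?case
  proof (cases "?fits (Suc p) (Suc n)")
    case True
    have "emb c a (Suc p) (Suc n) m \<longleftrightarrow> emb c a p n m"
      unfolding emb.simps by (rule if_P[OF True])
    also have "\<dots> \<longleftrightarrow> (\<exists>\<pi>\<in>Inc. \<forall>j\<in>{1..p}. \<pi> j \<le> n \<and> ?fits j (\<pi> j))"
      by (rule "3.IH"(1)[OF True])
    also have "(\<exists>\<pi>\<in>Inc. \<forall>j\<in>{1..p}. \<pi> j \<le> n \<and> ?fits j (\<pi> j)) \<longleftrightarrow>
        (\<exists>\<pi>\<in>Inc. \<forall>j\<in>{1..Suc p}. \<pi> j \<le> Suc n \<and> ?fits j (\<pi> j))" (is "?L \<longleftrightarrow> ?R")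
    proof
      assume ?L
      then obtain \<pi> where \<pi>: "\<pi> \<in> Inc" "\<forall>j\<in>{1..p}. \<pi> j \<le> n \<and> ?fits j (\<pi> j)" by blast
      \<comment> \<open>The last letter is sent to \<open>Suc n\<close>. The values beyond it do not
        affect the match, but \<open>Inc\<close> asks for a strictly increasing map on all positive
        integers, so they continue consecutively.\<close>
      define \<rho> where "\<rho> j = (if j \<le> p then \<pi> j else Suc n + (j - Suc p))" for j
      have "\<rho> \<in> Inc"
        unfolding Inc_def
      proof (rule CollectI, intro allI impI)
        fix j :: nat assume j: "1 \<le> j"
        have inc: "1 \<le> \<pi> j" "\<pi> j < \<pi> (Suc j)"
          using \<pi>(1) j unfolding Inc_def by blast+
        consider "j < p" | "j = p" | "p < j" by linarith
        then show "1 \<le> \<rho> j \<and> \<rho> j < \<rho> (Suc j)"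
        proof cases
          case 1
          with inc show ?thesis by (simp add: \<rho>_def)
        next
          case 2
          then have "\<pi> j \<le> n" using \<pi>(2) j by simp
          with 2 inc show ?thesis by (simp add: \<rho>_def)
        next
          case 3
          then show ?thesis by (simp add: \<rho>_def)
        qed
      qed
      moreover have "\<rho> j \<le> Suc n \<and> ?fits j (\<rho> j)" if "j \<in> {1..Suc p}" for j
      proof (cases "j = Suc p")
        case False
        then have "j \<in> {1..p}" using that by auto
        then show ?thesis using \<pi>(2) by (simp add: \<rho>_def le_SucI)
      qed (use True in \<open>simp add: \<rho>_def\<close>)
      ultimately show ?R by blast
    next
      assume ?R
      then obtain \<pi> where \<pi>: "\<pi> \<in> Inc" "\<forall>j\<in>{1..Suc p}. \<pi> j \<le> Suc n \<and> ?fits j (\<pi> j)" by blast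
      have le: "\<pi> (Suc p) \<le> Suc n" using \<pi>(2) by auto
      have "\<pi> j \<le> n \<and> ?fits j (\<pi> j)" if j: "j \<in> {1..p}" for j
      proof
        show "\<pi> j \<le> n" using below[OF \<pi>(1) j] le by linarith
        show "?fits j (\<pi> j)" using \<pi>(2) j by simp
      qed
      with \<pi>(1) show ?L by blast
    qed
    finally show ?thesis .
  next
    case False
    have "emb c a (Suc p) (Suc n) m \<longleftrightarrow> emb c a (Suc p) n m"
      unfolding emb.simps by (rule if_not_P[OF False])
    also have "\<dots> \<longleftrightarrow> (\<exists>\<pi>\<in>Inc. \<forall>j\<in>{1..Suc p}. \<pi> j \<le> n \<and> ?fits j (\<pi> j))"
      by (rule "3.IH"(2)[OF False])
    also have "(\<exists>\<pi>\<in>Inc. \<forall>j\<in>{1..Suc p}. \<pi> j \<le> n \<and> ?fits j (\<pi> j)) \<longleftrightarrow>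
        (\<exists>\<pi>\<in>Inc. \<forall>j\<in>{1..Suc p}. \<pi> j \<le> Suc n \<and> ?fits j (\<pi> j))" (is "?L \<longleftrightarrow> ?R")
    proof
      assume ?L
      then show ?R using le_SucI by blast
    next
      assume ?R
      then obtain \<pi> where \<pi>: "\<pi> \<in> Inc" "\<forall>j\<in>{1..Suc p}. \<pi> j \<le> Suc n \<and> ?fits j (\<pi> j)" by blast
      have "\<pi> (Suc p) \<le> Suc n" "?fits (Suc p) (\<pi> (Suc p))"
        using \<pi>(2) by auto
      moreover from this(2) have "\<pi> (Suc p) \<noteq> Suc n"
        using False by metis
      ultimately have le: "\<pi> (Suc p) \<le> n" by simp
      have "\<pi> j \<le> n \<and> ?fits j (\<pi> j)" if "j \<in> {1..Suc p}" for j
        using below[OF \<pi>(1), of j] \<pi>(2) le that by (cases "j = Suc p") auto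
      with \<pi>(1) show ?L by blast
    qed
    finally show ?thesis .
  qed
qed

lemma emb_cong:
  assumes "\<And>i k. i \<in> {1..c} \<Longrightarrow> k \<in> {1..n} \<Longrightarrow> Poly_Mapping.lookup m (i, k) = Poly_Mapping.lookup m' (i, k)"
  shows "emb c a p n m = emb c a p n m'"
  using assms by (induction c a p n m rule: emb.induct) auto

text \<open>With the full length for \<open>p\<close> these monomials will be a basis modulo the
  truncated ideal; the shorter prefixes are there for the recursion.\<close>

definition avoid :: "nat \<Rightarrow> (nat \<Rightarrow> nat \<Rightarrow> nat) \<Rightarrow> nat \<Rightarrow> nat \<Rightarrow> ((nat \<times> nat) \<Rightarrow>\<^sub>0 nat) set"
  where "avoid c a p n = {m \<in> monomials ({1..c} \<times> {1..n}). \<not> emb c a p n m}"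

text \<open>A monomial splits into its last column h and the rest m. If h fits the last letter
  (\<open>F\<close>), the greedy run consumes that letter and m must avoid the shorter word;
  otherwise (\<open>N\<close>) m must avoid the whole word.\<close>

lemma avoid_Suc_Suc:
  fixes c a p n
  defines "F \<equiv> {h \<in> monomials ({1..c} \<times> {Suc n}). \<forall>i\<in>{1..c}. a i (Suc p) \<le> Poly_Mapping.lookup h (i, Suc n)}"
    and "N \<equiv> {h \<in> monomials ({1..c} \<times> {Suc n}). \<not> (\<forall>i\<in>{1..c}. a i (Suc p) \<le> Poly_Mapping.lookup h (i, Suc n))}"
  shows "avoid c a (Suc p) (Suc n) =
    {m + h | m h. m \<in> avoid c a (Suc p) n \<and> h \<in> N} \<union> {m + h | m h. m \<in> avoid c a p n \<and> h \<in> F}"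
proof -
  let ?V = "{1..c} \<times> {1..n}" and ?W = "{1..c} \<times> {Suc n}"
  have split: "m + h \<in> avoid c a (Suc p) (Suc n) \<longleftrightarrow>
      (if h \<in> F then m \<in> avoid c a p n else m \<in> avoid c a (Suc p) n)"
    if m: "m \<in> monomials ?V" and h: "h \<in> monomials ?W" for m h
  proof -
    have "Poly_Mapping.lookup (m + h) (i, Suc n) = Poly_Mapping.lookup h (i, Suc n)" for i
    proof -
      have "(i, Suc n) \<notin> Poly_Mapping.keys m" using m by (auto simp: monomials_def)
      then show ?thesis by (simp add: lookup_add in_keys_iff)
    qed
    moreover have "emb c a q n (m + h) = emb c a q n m" for q
    proof (rule emb_cong)
      fix i k assume "k \<in> {1..n}"
      then have "(i, k) \<notin> Poly_Mapping.keys h" using h by (auto simp: monomials_def)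
      then show "Poly_Mapping.lookup (m + h) (i, k) = Poly_Mapping.lookup m (i, k)"
        by (simp add: lookup_add in_keys_iff)
    qed
    moreover have "m + h \<in> monomials ({1..c} \<times> {1..Suc n})"
      using m h by (fastforce simp: monomials_def keys_add_nat)
    ultimately show ?thesis
      using m h by (simp add: avoid_def F_def)
  qed
  have dec: "\<exists>m\<in>monomials ?V. \<exists>h\<in>monomials ?W. u = m + h"
    if u: "u \<in> monomials ({1..c} \<times> {1..Suc n})" for u
  proof (intro bexI)
    show "u = restr (- ?W) u + restr ?W u"
      by (rule poly_mapping_eqI) (simp add: lookup_add lookup_restr)
    have "({1..c} \<times> {1..Suc n}) - ?W \<subseteq> ?V" by (auto simp: le_Suc_eq)
    then show "restr (- ?W) u \<in> monomials ?V"
      using u by (auto simp: monomials_def keys_restr)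
    show "restr ?W u \<in> monomials ?W"
      by (simp add: monomials_def keys_restr)
  qed
  have sub: "avoid c a q n \<subseteq> monomials ?V" for q
    by (auto simp: avoid_def)
  show ?thesis
  proof (intro equalityI subsetI)
    fix u assume u: "u \<in> avoid c a (Suc p) (Suc n)"
    then obtain m h where mh: "m \<in> monomials ?V" "h \<in> monomials ?W" "u = m + h"
      using dec[of u] unfolding avoid_def by blast
    show "u \<in> {m + h | m h. m \<in> avoid c a (Suc p) n \<and> h \<in> N} \<union> {m + h | m h. m \<in> avoid c a p n \<and> h \<in> F}"
    proof (cases "h \<in> F")
      case True
      then show ?thesis using split[OF mh(1,2)] mh(3) u by auto
    next
      case False
      then have "h \<in> N" using mh(2) by (auto simp: F_def N_def)
      then show ?thesis using split[OF mh(1,2)] mh(3) u False by auto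
    qed
  next
    fix u assume "u \<in> {m + h | m h. m \<in> avoid c a (Suc p) n \<and> h \<in> N} \<union> {m + h | m h. m \<in> avoid c a p n \<and> h \<in> F}"
    then obtain m h where mh: "u = m + h"
      "m \<in> avoid c a (Suc p) n \<and> h \<in> N \<or> m \<in> avoid c a p n \<and> h \<in> F" by blast
    then have "m \<in> monomials ?V" "h \<in> monomials ?W"
      using sub by (auto simp: F_def N_def)
    from split[OF this] mh show "u \<in> avoid c a (Suc p) (Suc n)"
      by (auto simp: F_def N_def)
  qed
qed

lemma gf_fitting_column:
  fixes c k :: nat and w :: "nat \<Rightarrow> nat"
  shows "gf {h \<in> monomials ({1..c} \<times> {k}). \<forall>i\<in>{1..c}. w i \<le> Poly_Mapping.lookup h (i, k)} =
    fps_X ^ (\<Sum>i=1..c. w i) * gf (monomials ({1..c} \<times> {k}))"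
proof -
  define u where "u = (\<Sum>i=1..c. Poly_Mapping.single (i, k) (w i))"
  have lookup: "Poly_Mapping.lookup u (i, l) = (if i \<in> {1..c} \<and> l = k then w i else 0)" for i l
  proof -
    have "Poly_Mapping.lookup u (i, l) = (\<Sum>i'=1..c. if i' = i then (if l = k then w i else 0) else 0)"
      unfolding u_def lookup_sum by (rule sum.cong) (auto simp: lookup_single when_def)
    then show ?thesis by simp
  qed
  have keys: "Poly_Mapping.keys u \<subseteq> {1..c} \<times> {k}"
  proof
    fix v assume "v \<in> Poly_Mapping.keys u"
    then show "v \<in> {1..c} \<times> {k}"
      by (cases v) (auto simp: in_keys_iff lookup split: if_splits)
  qed
  have "mdeg u = (\<Sum>v\<in>{1..c} \<times> {k}. Poly_Mapping.lookup u v)"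
    by (rule mdeg_eq_sum[OF _ keys]) simp
  also have "\<dots> = (\<Sum>i=1..c. \<Sum>l\<in>{k}. Poly_Mapping.lookup u (i, l))"
    by (subst sum.cartesian_product) simp
  also have "\<dots> = (\<Sum>i=1..c. w i)"
    by (simp add: lookup)
  finally have deg: "mdeg u = (\<Sum>i=1..c. w i)" .
  have "{h \<in> monomials ({1..c} \<times> {k}). \<forall>i\<in>{1..c}. w i \<le> Poly_Mapping.lookup h (i, k)} =
      (\<lambda>m. u + m) ` monomials ({1..c} \<times> {k})"
  proof (intro equalityI subsetI)
    fix h assume h: "h \<in> {h \<in> monomials ({1..c} \<times> {k}). \<forall>i\<in>{1..c}. w i \<le> Poly_Mapping.lookup h (i, k)}"
    \<comment> \<open>Subtraction of exponents is truncated; it is exact here because h dominates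
      \<open>u\<close>.\<close>
    have "h = u + (h - u)"
    proof (rule poly_mapping_eqI)
      fix v
      show "Poly_Mapping.lookup h v = Poly_Mapping.lookup (u + (h - u)) v"
        using h by (cases v) (auto simp: lookup_add lookup_minus lookup)
    qed
    moreover have "Poly_Mapping.keys (h - u) \<subseteq> Poly_Mapping.keys h"
      by (auto simp: in_keys_iff lookup_minus)
    then have "h - u \<in> monomials ({1..c} \<times> {k})"
      using h unfolding monomials_def by blast
    ultimately show "h \<in> (\<lambda>m. u + m) ` monomials ({1..c} \<times> {k})" by blast
  next
    fix h assume "h \<in> (\<lambda>m. u + m) ` monomials ({1..c} \<times> {k})"
    then obtain m where m: "m \<in> monomials ({1..c} \<times> {k})" "h = u + m" by blast
    then have "h \<in> monomials ({1..c} \<times> {k})"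
      using keys by (simp add: monomials_def keys_add_nat)
    with m(2) show "h \<in> {h \<in> monomials ({1..c} \<times> {k}). \<forall>i\<in>{1..c}. w i \<le> Poly_Mapping.lookup h (i, k)}"
      by (auto simp: lookup_add lookup)
  qed
  then show ?thesis
    by (simp add: gf_shift deg)
qed

text \<open>The boundary values reflect that no monomial avoids the empty word, and that without
  columns the only monomial, 1, avoids every non-empty word.\<close>

fun numer :: "(nat \<Rightarrow> nat) \<Rightarrow> nat \<Rightarrow> nat \<Rightarrow> int poly"
  where
    "numer \<beta> 0 n = 0"
  | "numer \<beta> (Suc p) 0 = 1"
  | "numer \<beta> (Suc p) (Suc n) =
      (1 - [:0, 1:] ^ \<beta> (Suc p)) * numer \<beta> (Suc p) n + [:0, 1:] ^ \<beta> (Suc p) * numer \<beta> p n"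

lemma gf_avoid:
  "gf (avoid c a p n) * (1 - fps_X) ^ (c * n) = fps_of_poly (numer (\<lambda>j. \<Sum>i=1..c. a i j) p n)"
proof (induction "\<lambda>j. \<Sum>i=1..c. a i j" p n rule: numer.induct)
  case (1 n)
  have "avoid c a 0 n = {}" by (simp add: avoid_def)
  then have "gf (avoid c a 0 n) = 0" by (simp add: gf_def fps_eq_iff)
  then show ?case by simp
next
  case (2 p)
  have "avoid c a (Suc p) 0 = monomials {}" by (simp add: avoid_def)
  then show ?case using gf_monomials[of "{} :: (nat \<times> nat) set"] by simp
next
  case (3 p n)
  let ?V = "{1..c} \<times> {1..n}" and ?W = "{1..c} \<times> {Suc n}"
  let ?b = "\<Sum>i=1..c. a i (Suc p)"
  define F where "F = {h \<in> monomials ?W. \<forall>i\<in>{1..c}. a i (Suc p) \<le> Poly_Mapping.lookup h (i, Suc n)}"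
  define N where "N = {h \<in> monomials ?W. \<not> (\<forall>i\<in>{1..c}. a i (Suc p) \<le> Poly_Mapping.lookup h (i, Suc n))}"
  have sub: "avoid c a q n \<subseteq> monomials ?V" for q
    by (auto simp: avoid_def)
  have FN: "F \<subseteq> monomials ?W" "N \<subseteq> monomials ?W" "F \<inter> N = {}" "F \<union> N = monomials ?W"
    by (auto simp: F_def N_def)
  have W: "gf (monomials ?W) * (1 - fps_X) ^ c = 1"
    using gf_monomials[of ?W] by (simp add: card_cartesian_product)
  have gF: "gf F = fps_X ^ ?b * gf (monomials ?W)"
    unfolding F_def by (rule gf_fitting_column)
  have "gf (monomials ?W) = gf F + gf N"
    using gf_Un_disjoint[of ?W F N] FN by simp
  with gF have gN: "gf N = (1 - fps_X ^ ?b) * gf (monomials ?W)"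
    by (simp add: algebra_simps)
  have disj: "{m + h | m h. m \<in> avoid c a (Suc p) n \<and> h \<in> N} \<inter> {m + h | m h. m \<in> avoid c a p n \<and> h \<in> F} = {}"
  proof (rule ccontr)
    assume "\<not> ?thesis"
    then obtain m h m' h' where mh: "m \<in> avoid c a (Suc p) n" "h \<in> N" "m' \<in> avoid c a p n" "h' \<in> F"
      "m + h = m' + h'" by auto
    have "h = h'"
    proof -
      have "?V \<inter> ?W = {}" by auto
      then show ?thesis
        using add_eq_disjoint_keys[of m ?V m' h ?W h'] mh subsetD[OF sub] FN(1,2) by blast
    qed
    with mh FN(3) show False by blast
  qed
  have gV: "gf {m + h | m h. m \<in> avoid c a q n \<and> h \<in> T} = gf (avoid c a q n) * gf T"
    if "T \<subseteq> monomials ?W" for q T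
    by (rule gf_sum_disjoint_keys[OF _ sub _ that]) auto
  have mono: "{m + h | m h. m \<in> avoid c a q n \<and> h \<in> T} \<subseteq> monomials ({1..c} \<times> {1..Suc n})"
    if "T \<subseteq> monomials ?W" for q T
    using sub[of q] that by (fastforce simp: monomials_def keys_add_nat)
  have "gf (avoid c a (Suc p) (Suc n)) = gf (avoid c a (Suc p) n) * gf N + gf (avoid c a p n) * gf F"
    unfolding avoid_Suc_Suc F_def[symmetric] N_def[symmetric]
      gV[OF FN(1), symmetric] gV[OF FN(2), symmetric]
    by (rule gf_Un_disjoint[OF _ mono[OF FN(2)] mono[OF FN(1)] disj]) simp
  \<comment> \<open>A regrouping that lets each factor meet its own denominator: \<open>w\<close> is
    the power belonging to the first n columns, \<open>z\<close> the power belonging to the new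
    column, whose series is \<open>g\<close>.\<close>
  moreover have "(P * ((1 - y) * g) + Q * (y * g)) * (z * w) = ((1 - y) * (P * w) + y * (Q * w)) * (g * z)"
    for P Q y g z w :: "int fps"
    by (simp add: algebra_simps)
  ultimately have "gf (avoid c a (Suc p) (Suc n)) * (1 - fps_X) ^ (c * Suc n) =
      ((1 - fps_X ^ ?b) * (gf (avoid c a (Suc p) n) * (1 - fps_X) ^ (c * n)) +
      fps_X ^ ?b * (gf (avoid c a p n) * (1 - fps_X) ^ (c * n))) * (gf (monomials ?W) * (1 - fps_X) ^ c)"
    unfolding gF gN mult_Suc_right power_add by (simp only:)
  also have "\<dots> = fps_of_poly (numer (\<lambda>j. \<Sum>i=1..c. a i j) (Suc p) (Suc n))"
    unfolding W 3 by (simp add: fps_of_poly_simps)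
  finally show ?case .
qed

section \<open>Prime ideals of a quotient ring\<close>

context cring
begin

lemma quot_carrierE:
  assumes "X \<in> carrier (R Quot J)"
  obtains x where "x \<in> carrier R" "X = J +> x"
  using assms that unfolding FactRing_def A_RCOSETS_def'[of R J] by auto

lemma primeideal_quot_vimage:
  assumes J: "ideal J R" and P: "primeideal P (R Quot J)"
  shows "primeideal {x \<in> carrier R. J +> x \<in> P} R" "J \<subseteq> {x \<in> carrier R. J +> x \<in> P}"
proof -
  interpret J: ideal J R by fact
  interpret P: primeideal P "R Quot J" by fact
  interpret h: ring_hom_ring R "R Quot J" "(+>) J" by (rule J.rcos_ring_hom_ring)
  have zero: "\<zero>\<^bsub>R Quot J\<^esub> \<in> P"
    using additive_subgroup.zero_closed[OF P.is_additive_subgroup] .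
  show "J \<subseteq> {x \<in> carrier R. J +> x \<in> P}"
  proof
    fix x assume x: "x \<in> J"
    have "J \<in> P" using zero unfolding FactRing_def by (simp only: ring.simps)
    then have "J +> x \<in> P" by (simp only: a_rcos_zero[OF J x])
    then show "x \<in> {x \<in> carrier R. J +> x \<in> P}" using J.Icarr[OF x] by blast
  qed
  show "primeideal {x \<in> carrier R. J +> x \<in> P} R"
  proof (rule primeidealI[OF h.ideal_vimage[OF P.is_ideal] is_cring])
    have "\<one>\<^bsub>R Quot J\<^esub> \<notin> P"
      using P.one_imp_carrier P.I_notcarr by blast
    then have "\<one> \<notin> {x \<in> carrier R. J +> x \<in> P}"
      by (simp add: h.hom_one)
    then show "carrier R \<noteq> {x \<in> carrier R. J +> x \<in> P}"
      using one_closed by blast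
  next
    fix x y assume xy: "x \<in> carrier R" "y \<in> carrier R" "x \<otimes> y \<in> {x \<in> carrier R. J +> x \<in> P}"
    then have "(J +> x) \<otimes>\<^bsub>R Quot J\<^esub> (J +> y) \<in> P"
      by (simp add: h.hom_mult)
    then have "J +> x \<in> P \<or> J +> y \<in> P"
      by (rule P.I_prime[OF h.hom_closed[OF xy(1)] h.hom_closed[OF xy(2)]])
    then show "x \<in> {x \<in> carrier R. J +> x \<in> P} \<or> y \<in> {x \<in> carrier R. J +> x \<in> P}"
      using xy(1,2) by blast
  qed
qed

text \<open>An ideal that contains \<open>J\<close> is a union of cosets of \<open>J\<close>, so its
  image in the quotient still determines it. This keeps inclusions strict when chains are pushed to
  the quotient.\<close>

lemma coset_mem_image_ideal_iff:
  assumes J: "ideal J R" and Q: "ideal Q R" "J \<subseteq> Q" and x: "x \<in> carrier R"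
  shows "J +> x \<in> (+>) J ` Q \<longleftrightarrow> x \<in> Q"
proof
  interpret Q: ideal Q R by fact
  assume "J +> x \<in> (+>) J ` Q"
  then obtain q where q: "q \<in> Q" "J +> x = J +> q" by blast
  then have "x \<ominus> q \<in> Q"
    using quotient_eq_iff_same_a_r_cos[OF J x] Q.Icarr Q(2) by blast
  then have "(x \<ominus> q) \<oplus> q \<in> Q"
    using q(1) Q.a_closed by blast
  moreover have "(x \<ominus> q) \<oplus> q = x"
    using x Q.Icarr[OF q(1)] by (simp add: minus_eq a_assoc l_neg)
  ultimately show "x \<in> Q" by simp
qed simp

lemma primeideal_quot_image:
  assumes J: "ideal J R" and Q: "primeideal Q R" "J \<subseteq> Q"
  shows "primeideal ((+>) J ` Q) (R Quot J)"
proof -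
  interpret J: ideal J R by fact
  interpret Q: primeideal Q R by fact
  interpret h: ring_hom_ring R "R Quot J" "(+>) J" by (rule J.rcos_ring_hom_ring)
  note mem = coset_mem_image_ideal_iff[OF J Q.is_ideal Q(2)]
  show ?thesis
  proof (rule primeidealI[OF ring_ideal_imp_quot_ideal[OF J Q.is_ideal] J.quotient_is_cring[OF is_cring]])
    have "\<one> \<notin> Q" using Q.one_imp_carrier Q.I_notcarr by blast
    then show "carrier (R Quot J) \<noteq> (+>) J ` Q"
      using mem[OF one_closed] h.hom_closed[OF one_closed] by auto
    fix X Y assume XY: "X \<in> carrier (R Quot J)" "Y \<in> carrier (R Quot J)"
      "X \<otimes>\<^bsub>R Quot J\<^esub> Y \<in> (+>) J ` Q"
    obtain x y where xy: "x \<in> carrier R" "X = J +> x" "y \<in> carrier R" "Y = J +> y"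
      using quot_carrierE XY(1,2) by metis
    then have "J +> (x \<otimes> y) \<in> (+>) J ` Q"
      using XY(3) by (simp only: h.hom_mult)
    then have "x \<in> Q \<or> y \<in> Q"
      using mem xy Q.I_prime by blast
    then show "X \<in> (+>) J ` Q \<or> Y \<in> (+>) J ` Q"
      using xy by blast
  qed
qed

text \<open>Preimages and images translate chains in the quotient into chains of primes above
  \<open>J\<close> and back, so that all later work takes place in the polynomial ring.\<close>

lemma krull_dim_quot:
  assumes J: "ideal J R"
  shows "krull_dim (R Quot J) = Sup {enat l | l. \<exists>P.
    (\<forall>i\<le>l. primeideal (P i) R \<and> J \<subseteq> P i) \<and> (\<forall>i<l. P i \<subset> P (Suc i))}"
proof -
  have "(\<exists>P. (\<forall>i\<le>l. primeideal (P i) (R Quot J)) \<and> (\<forall>i<l. P i \<subset> P (Suc i))) \<longleftrightarrow>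
      (\<exists>P. (\<forall>i\<le>l. primeideal (P i) R \<and> J \<subseteq> P i) \<and> (\<forall>i<l. P i \<subset> P (Suc i)))" (is "?L \<longleftrightarrow> ?R") for l
  proof
    assume ?L
    then obtain P where P: "\<And>i. i \<le> l \<Longrightarrow> primeideal (P i) (R Quot J)" "\<And>i. i < l \<Longrightarrow> P i \<subset> P (Suc i)"
      by blast
    let ?P = "\<lambda>i. {x \<in> carrier R. J +> x \<in> P i}"
    have "?P i \<subset> ?P (Suc i)" if i: "i < l" for i
    proof -
      \<comment> \<open>Strictness survives because every element of the quotient is the coset of
        some ring element.\<close>
      obtain X where X: "X \<in> P (Suc i)" "X \<notin> P i" using P(2)[OF i] by blast
      have "primeideal (P (Suc i)) (R Quot J)" using P(1) i by simp
      then have "X \<in> carrier (R Quot J)"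
        using X(1) by (rule ideal.Icarr[OF primeideal.axioms(1)])
      then obtain x where "x \<in> carrier R" "X = J +> x"
        by (rule quot_carrierE)
      with X P(2)[OF i] show ?thesis by blast
    qed
    then show ?R
      using primeideal_quot_vimage[OF J P(1)] by (intro exI[of _ ?P] conjI allI impI)
  next
    assume ?R
    then obtain P where P: "\<And>i. i \<le> l \<Longrightarrow> primeideal (P i) R" "\<And>i. i \<le> l \<Longrightarrow> J \<subseteq> P i"
      "\<And>i. i < l \<Longrightarrow> P i \<subset> P (Suc i)"
      by blast
    have "(+>) J ` P i \<subset> (+>) J ` P (Suc i)" if i: "i < l" for i
    proof -
      obtain x where x: "x \<in> P (Suc i)" "x \<notin> P i" using P(3)[OF i] by blast
      have "primeideal (P (Suc i)) R" using P(1) i by simp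
      then have "x \<in> carrier R"
        using x(1) by (rule ideal.Icarr[OF primeideal.axioms(1)])
      then have "J +> x \<notin> (+>) J ` P i"
        using coset_mem_image_ideal_iff[OF J primeideal.axioms(1)[OF P(1)] P(2)] i x(2) by simp
      with x(1) P(3)[OF i] show ?thesis by blast
    qed
    then show ?L
      using primeideal_quot_image[OF J P(1) P(2)]
      by (intro exI[of _ "\<lambda>i. (+>) J ` P i"] conjI allI impI)
  qed
  then show ?thesis
    unfolding krull_dim_def by simp
qed

end

section \<open>Prime ideals generated by variables\<close>

text \<open>For \<open>U \<subseteq> V\<close> this is the ideal generated by the variables in
  \<open>U\<close>, in the form of a membership test: every monomial involves one of them.\<close>

definition var_ideal :: "(nat \<times> nat) set \<Rightarrow> (nat \<times> nat) set \<Rightarrow> 'k::field pol set"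
  where "var_ideal V U = mono_ideal V {m. Poly_Mapping.keys m \<inter> U \<noteq> {}}"

lemma up_closed_meets: "up_closed {m. Poly_Mapping.keys m \<inter> U \<noteq> {}}"
  unfolding up_closed_def by (auto simp: keys_add_nat)

lemma var_ideal_minimal:
  fixes P :: "'k::field pol set"
  assumes P: "ideal P (poly_ring V)" and U: "U \<subseteq> V"
    and vars: "\<And>u. u \<in> U \<Longrightarrow> Poly_Mapping.single (Poly_Mapping.single u 1) 1 \<in> P"
  shows "var_ideal V U \<subseteq> P"
proof -
  interpret ring "poly_ring V :: 'k pol ring" by (rule ring_poly_ring)
  let ?G = "(\<lambda>u. Poly_Mapping.single u 1) ` U :: ((nat \<times> nat) \<Rightarrow>\<^sub>0 nat) set"
  have "\<exists>g h. m = g + h \<and> g \<in> ?G" if "u \<in> Poly_Mapping.keys m" "u \<in> U" for m u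
  proof (intro exI conjI)
    show "m = Poly_Mapping.single u 1 + (m - Poly_Mapping.single u 1)"
      using that(1) by (intro poly_mapping_eqI)
        (auto simp: lookup_add lookup_minus lookup_single when_def in_keys_iff)
    show "Poly_Mapping.single u 1 \<in> ?G" using that by blast
  qed
  then have "{m. Poly_Mapping.keys m \<inter> U \<noteq> {}} \<subseteq> {g + h | g h. g \<in> ?G}"
    by blast
  then have "var_ideal V U \<subseteq> (mono_ideal V {g + h | g h. g \<in> ?G} :: 'k pol set)"
    unfolding var_ideal_def mono_ideal_def by blast
  also have "\<dots> = Idl\<^bsub>poly_ring V\<^esub> ((\<lambda>g. Poly_Mapping.single g 1) ` ?G)"
    using U by (intro genideal_monomials[symmetric]) auto
  also have "\<dots> \<subseteq> P"
    using vars by (intro genideal_minimal[OF P]) auto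
  finally show ?thesis .
qed

text \<open>Modulo the ideal, both factors may be replaced by their parts free of \<open>U\<close>.
  The product of these parts is free of \<open>U\<close> as well, so it lies in the ideal only if it
  is zero.\<close>

lemma primeideal_var_ideal: "primeideal (var_ideal V U :: 'k::field pol set) (poly_ring V)"
proof (rule primeidealI)
  show "ideal (var_ideal V U :: 'k pol set) (poly_ring V)"
    unfolding var_ideal_def by (rule ideal_mono_ideal[OF up_closed_meets])
  show "cring (poly_ring V :: 'k pol ring)" by (rule poly_ring_cring)
  have "(1 :: 'k pol) \<notin> var_ideal V U" by (simp add: var_ideal_def mono_ideal_def)
  moreover have "(1 :: 'k pol) \<in> carrier (poly_ring V)" by simp
  ultimately show "carrier (poly_ring V) \<noteq> (var_ideal V U :: 'k pol set)" by metis
next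
  fix p q :: "'k pol"
  assume p: "p \<in> carrier (poly_ring V)" and q: "q \<in> carrier (poly_ring V)"
    and pq: "p \<otimes>\<^bsub>poly_ring V\<^esub> q \<in> var_ideal V U"
  let ?M = "{m :: (nat \<times> nat) \<Rightarrow>\<^sub>0 nat. Poly_Mapping.keys m \<inter> U \<noteq> {}}"
  interpret cring "poly_ring V :: 'k pol ring" by (rule poly_ring_cring)
  let ?p = "restr (- ?M) p" and ?q = "restr (- ?M) q"
  have id: "ideal (var_ideal V U :: 'k pol set) (poly_ring V)"
    unfolding var_ideal_def by (rule ideal_mono_ideal[OF up_closed_meets])
  have diff: "p - ?p \<in> var_ideal V U" "q - ?q \<in> var_ideal V U"
    unfolding var_ideal_def using p q by (auto intro: diff_restr_mono_ideal)
  have cp: "?p \<in> carrier (poly_ring V)" using p by (simp add: keys_restr)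
  have "p * q - ?p * ?q = q * (p - ?p) + ?p * (q - ?q)"
    by (simp add: algebra_simps)
  also have "\<dots> \<in> var_ideal V U"
    using diff cp q by (intro ideal_poly_ringD(3)[OF id] ideal_poly_ringD(5)[OF id])
  finally have d: "p * q - ?p * ?q \<in> var_ideal V U" .
  have "p * q \<in> var_ideal V U" using pq by simp
  from ideal_poly_ringD(4)[OF id this d] have "?p * ?q \<in> var_ideal V U" by simp
  then have "Poly_Mapping.keys (?p * ?q) \<subseteq> ?M"
    by (simp add: var_ideal_def mono_ideal_def)
  moreover have "Poly_Mapping.keys (?p * ?q) \<subseteq> - ?M"
  proof
    fix m assume "m \<in> Poly_Mapping.keys (?p * ?q)"
    then obtain g h where "m = g + h" "g \<in> Poly_Mapping.keys ?p" "h \<in> Poly_Mapping.keys ?q"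
      using keys_mult[of ?p ?q] by blast
    then show "m \<in> - ?M" by (auto simp: keys_restr keys_add_nat)
  qed
  ultimately have "Poly_Mapping.keys (?p * ?q) = {}" by blast
  then have "?p * ?q = 0" by simp
  \<comment> \<open>Polynomials have no zero divisors because exponent vectors carry a linear order
    compatible with addition; it rests on the lexicographic order of the index pairs.\<close>
  then have "?p = 0 \<or> ?q = 0" by simp
  then show "p \<in> var_ideal V U \<or> q \<in> var_ideal V U"
    using diff by auto
qed

text \<open>Adjoining the variables outside \<open>U\<close> one at a time gives a strict chain of
  primes above \<open>J\<close>.\<close>

lemma krull_dim_quot_ge:
  fixes J :: "'k::field pol set"
  assumes V: "finite V" and U: "U \<subseteq> V" and J: "ideal J (poly_ring V)" "J \<subseteq> var_ideal V U"
  shows "enat (card (V - U)) \<le> krull_dim (poly_ring V Quot J)"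
proof -
  interpret cring "poly_ring V :: 'k pol ring" by (rule poly_ring_cring)
  obtain f where f: "bij_betw f {0..<card (V - U)} (V - U)"
    using V ex_bij_betw_nat_finite by (metis finite_Diff)
  define P where "P k = (var_ideal V (U \<union> f ` {..<k}) :: 'k pol set)" for k
  have "J \<subseteq> P k" for k
    using J(2) unfolding P_def var_ideal_def mono_ideal_def by blast
  moreover have "primeideal (P k) (poly_ring V)" for k
    unfolding P_def by (rule primeideal_var_ideal)
  moreover have "P k \<subset> P (Suc k)" if k: "k < card (V - U)" for k
  proof
    show "P k \<subseteq> P (Suc k)"
      unfolding P_def var_ideal_def mono_ideal_def by (auto simp: lessThan_Suc)
    have "{..<k} \<subseteq> {0..<card (V - U)}" using k by auto
    then have "f k \<notin> f ` {..<k}"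
      using inj_on_image_mem_iff[OF bij_betw_imp_inj_on[OF f], of k "{..<k}"] k by simp
    moreover have "f k \<in> V - U"
      using bij_betwE[OF f] k by simp
    ultimately have fk: "f k \<in> V - U" "f k \<notin> f ` {..<k}" by blast+
    let ?x = "Poly_Mapping.single (Poly_Mapping.single (f k) 1) 1 :: 'k pol"
    have "?x \<in> P (Suc k)" "?x \<notin> P k"
      using fk by (auto simp: P_def var_ideal_def mono_ideal_def)
    then show "P k \<noteq> P (Suc k)" by blast
  qed
  ultimately show ?thesis
    unfolding krull_dim_quot[OF J(1)] by (intro Sup_upper CollectI exI[of _ P] exI) auto
qed


section \<open>Chains of prime ideals\<close>

text \<open>The elements \<open>x i\<close> cannot satisfy a polynomial relation modulo \<open>P 0\<close>: cancel the smallest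
  power of \<open>x 0\<close> modulo \<open>P 0\<close>, reduce modulo \<open>P 1\<close> to get rid of the remaining occurrences of
  \<open>x 0\<close>, and go on with \<open>x 1\<close>.\<close>

lemma chain_algebraically_independent:
  fixes P :: "nat \<Rightarrow> 'k::field pol set" and \<epsilon> :: "'e \<Rightarrow> nat \<Rightarrow> nat"
  assumes "\<And>i. i \<le> l \<Longrightarrow> primeideal (P i) (poly_ring V)"
    and "\<And>i. i < l \<Longrightarrow> P i \<subseteq> P (Suc i)"
    and "\<And>i. i < l \<Longrightarrow> x i \<in> P (Suc i) - P i"
    and "finite E" "E \<noteq> {}" "\<And>e. e \<in> E \<Longrightarrow> k e \<noteq> 0"
    and "\<And>e e'. e \<in> E \<Longrightarrow> e' \<in> E \<Longrightarrow> (\<And>i. i < l \<Longrightarrow> \<epsilon> e i = \<epsilon> e' i) \<Longrightarrow> e = e'"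
  shows "(\<Sum>e\<in>E. const (k e) * (\<Prod>i<l. x i ^ \<epsilon> e i)) \<notin> P 0"
  using assms
proof (induction l arbitrary: P x E \<epsilon>)
  case 0
  \<comment> \<open>Without any x the separation condition on exponents is vacuous, so all members
    of \<open>E\<close> coincide.\<close>
  then obtain e where e: "E = {e}" by blast
  interpret primeideal "P 0" "poly_ring V :: 'k pol ring" using 0 by simp
  show ?case
  proof
    assume "(\<Sum>e\<in>E. const (k e) * (\<Prod>i<0. x i ^ \<epsilon> e i)) \<in> P 0"
    then have "const (k e) \<in> P 0" by (simp add: e)
    then have "const (inverse (k e)) * const (k e) \<in> P 0"
      by (rule ideal_poly_ringD(5)[OF is_ideal _ const_in_carrier])
    then have "1 \<in> P 0"
      using "0.prems"(6)[of e] by (simp add: e const_mult[symmetric])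
    then show False
      using one_imp_carrier I_notcarr by simp
  qed
next
  case (Suc l)
  interpret P0: primeideal "P 0" "poly_ring V :: 'k pol ring" using Suc.prems(1) by simp
  interpret P1: primeideal "P (Suc 0)" "poly_ring V :: 'k pol ring" using Suc.prems(1) by simp
  have x0: "x 0 \<in> P (Suc 0)" "x 0 \<notin> P 0" using Suc.prems(3)[of 0] by auto
  have xc: "x i \<in> carrier (poly_ring V)" if i: "i < Suc l" for i
  proof -
    have "primeideal (P (Suc i)) (poly_ring V)" using Suc.prems(1) i by simp
    then have "P (Suc i) \<subseteq> carrier (poly_ring V)"
      using ideal_poly_ringD(1) primeideal.axioms(1) by blast
    with Suc.prems(3)[OF i] show ?thesis by blast
  qed
  have powc: "p ^ j \<in> carrier (poly_ring V)" if "p \<in> carrier (poly_ring V)" for p :: "'k pol" and j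
  proof (induction j)
    case (Suc j)
    then show ?case using P0.m_closed[OF that Suc] by simp
  qed simp
  have prodc: "(\<Prod>i\<in>A. x (Suc i) ^ \<epsilon> e (Suc i)) \<in> carrier (poly_ring V)" if "A \<subseteq> {..<l}" for A e
    using that
  proof (induction A rule: infinite_finite_induct)
    case (insert i A)
    then have "x (Suc i) ^ \<epsilon> e (Suc i) \<in> carrier (poly_ring V)"
      by (intro powc xc) auto
    then show ?case
      using P0.m_closed insert by (simp del: carrier_poly_ring)
  qed simp_all
  define T where "T e = const (k e) * (\<Prod>i<l. x (Suc i) ^ \<epsilon> e (Suc i))" for e
  have Tc: "T e \<in> carrier (poly_ring V)" for e
    unfolding T_def using P0.m_closed[OF const_in_carrier prodc[OF order_refl]] by simp
  define \<mu> where "\<mu> = Min ((\<lambda>e. \<epsilon> e 0) ` E)"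
  have \<mu>: "\<mu> \<le> \<epsilon> e 0" if "e \<in> E" for e
    unfolding \<mu>_def using that Suc.prems(4) by simp
  have "\<mu> \<in> (\<lambda>e. \<epsilon> e 0) ` E"
    unfolding \<mu>_def using Suc.prems(4,5) by (intro Min_in) auto
  then obtain e0 where e0: "e0 \<in> E" "\<epsilon> e0 0 = \<mu>" by blast
  define E0 where "E0 = {e \<in> E. \<epsilon> e 0 = \<mu>}"
  define S where "S = (\<Sum>e\<in>E. x 0 ^ (\<epsilon> e 0 - \<mu>) * T e)"
  have S: "S = (\<Sum>e\<in>E0. T e) + (\<Sum>e\<in>E - E0. x 0 ^ (\<epsilon> e 0 - \<mu>) * T e)"
  proof -
    have "S = (\<Sum>e\<in>E0. x 0 ^ (\<epsilon> e 0 - \<mu>) * T e) + (\<Sum>e\<in>E - E0. x 0 ^ (\<epsilon> e 0 - \<mu>) * T e)"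
      unfolding S_def using Suc.prems(4) sum.subset_diff[of E0 E "\<lambda>e. x 0 ^ (\<epsilon> e 0 - \<mu>) * T e"]
      by (simp add: E0_def add.commute)
    then show ?thesis by (simp add: E0_def)
  qed
  have Sc: "S \<in> carrier (poly_ring V)"
    unfolding S_def
  proof (rule ideal_sum_closed[OF P0.oneideal])
    fix e
    show "x 0 ^ (\<epsilon> e 0 - \<mu>) * T e \<in> carrier (poly_ring V)"
      using P0.m_closed[OF powc[OF xc[of 0]] Tc] by simp
  qed
  have IH: "(\<Sum>e\<in>E0. T e) \<notin> P (Suc 0)"
    unfolding T_def
  proof (rule Suc.IH[of "\<lambda>i. P (Suc i)" "\<lambda>i. x (Suc i)" E0 "\<lambda>e i. \<epsilon> e (Suc i)"])
    fix e e' assume e: "e \<in> E0" "e' \<in> E0" "\<And>i. i < l \<Longrightarrow> \<epsilon> e (Suc i) = \<epsilon> e' (Suc i)"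
    have "\<epsilon> e i = \<epsilon> e' i" if "i < Suc l" for i
      using e that by (cases i) (auto simp: E0_def)
    then show "e = e'" using Suc.prems(7)[of e e'] e by (simp add: E0_def)
  qed (use Suc.prems e0 in \<open>auto simp: E0_def\<close>)
  have rest: "(\<Sum>e\<in>E - E0. x 0 ^ (\<epsilon> e 0 - \<mu>) * T e) \<in> P (Suc 0)"
  proof (rule ideal_sum_closed[OF P1.is_ideal])
    fix e assume e: "e \<in> E - E0"
    then obtain j where j: "\<epsilon> e 0 - \<mu> = Suc j"
      using \<mu>[of e] by (cases "\<epsilon> e 0 - \<mu>") (auto simp: E0_def)
    have "x 0 ^ j * T e \<in> carrier (poly_ring V)"
      using P0.m_closed[OF powc[OF xc[of 0]] Tc] by simp
    then have "(x 0 ^ j * T e) * x 0 \<in> P (Suc 0)"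
      by (rule ideal_poly_ringD(5)[OF P1.is_ideal x0(1)])
    then show "x 0 ^ (\<epsilon> e 0 - \<mu>) * T e \<in> P (Suc 0)"
      by (simp add: j mult_ac)
  qed
  have cancel: "S \<in> P 0" if "x 0 ^ j * S \<in> P 0" for j
    using that
  proof (induction j)
    case (Suc j)
    have "x 0 ^ j * S \<in> carrier (poly_ring V)"
      using P0.m_closed[OF powc[OF xc[of 0]] Sc] by simp
    moreover have "x 0 * (x 0 ^ j * S) \<in> P 0" using Suc.prems by (simp add: mult_ac)
    ultimately have "x 0 ^ j * S \<in> P 0"
      using P0.I_prime[of "x 0" "x 0 ^ j * S"] x0(2) xc[of 0] by simp
    then show ?case by (rule Suc.IH)
  qed simp
  show ?case
  proof
    assume "(\<Sum>e\<in>E. const (k e) * (\<Prod>i<Suc l. x i ^ \<epsilon> e i)) \<in> P 0"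
    also have "(\<Sum>e\<in>E. const (k e) * (\<Prod>i<Suc l. x i ^ \<epsilon> e i)) = x 0 ^ \<mu> * S"
      unfolding S_def sum_distrib_left
    proof (rule sum.cong)
      fix e assume "e \<in> E"
      then have "x 0 ^ \<epsilon> e 0 = x 0 ^ \<mu> * x 0 ^ (\<epsilon> e 0 - \<mu>)"
        using \<mu> by (simp flip: power_add)
      then show "const (k e) * (\<Prod>i<Suc l. x i ^ \<epsilon> e i) = x 0 ^ \<mu> * (x 0 ^ (\<epsilon> e 0 - \<mu>) * T e)"
        unfolding prod.lessThan_Suc_shift T_def by (simp add: mult_ac)
    qed simp
    finally have "S \<in> P 0" by (rule cancel)
    then have "S \<in> P (Suc 0)" using Suc.prems(2)[of 0] by blast
    from ideal_poly_ringD(4)[OF P1.is_ideal this rest] IH S show False by simp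
  qed
qed

text \<open>The vectors are indexed by \<open>E\<close> instead of being collected in a set, so that
  a repeated value of \<open>f\<close> also yields a relation, with coefficients 1 and -1.\<close>

lemma (in vector_space) exists_relation:
  assumes E: "finite E" and T: "finite T" "card T < card E" and f: "f ` E \<subseteq> span T"
  shows "\<exists>k. (\<exists>e\<in>E. k e \<noteq> 0) \<and> (\<Sum>e\<in>E. scale (k e) (f e)) = 0"
proof (cases "inj_on f E")
  case True
  then have "dependent (f ` E)"
    using independent_span_bound[OF T(1) _ f] T(2) by (auto simp: card_image)
  then obtain u where u: "\<exists>v\<in>f ` E. u v \<noteq> 0" "(\<Sum>v\<in>f ` E. scale (u v) v) = 0"
    using dependent_finite[of "f ` E"] E by auto
  then show ?thesis
    using True by (intro exI[of _ "u \<circ> f"]) (auto simp: sum.reindex)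
next
  case False
  then obtain e e' where e: "e \<in> E" "e' \<in> E" "e \<noteq> e'" "f e = f e'"
    by (auto simp: inj_on_def)
  let ?k = "\<lambda>i. if i = e then 1 else if i = e' then - 1 else 0"
  have "(\<Sum>i\<in>E. scale (?k i) (f i)) = (\<Sum>i\<in>{e, e'}. scale (?k i) (f i))"
    using E e by (intro sum.mono_neutral_right) auto
  also have "\<dots> = 0" using e by simp
  finally show ?thesis
    using e(1) by (intro exI[of _ ?k]) auto
qed

lemma vector_space_const_mult: "vector_space (\<lambda>k p. const k * p :: 'k::field pol)"
  by unfold_locales (simp_all add: algebra_simps const_add const_mult)

definition deg_bounded :: "nat \<Rightarrow> 'k::field pol \<Rightarrow> bool"
  where "deg_bounded d p \<longleftrightarrow> (\<forall>m\<in>Poly_Mapping.keys p. mdeg m \<le> d)"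

lemma deg_bounded_mult:
  assumes "deg_bounded d p" "deg_bounded d' q"
  shows "deg_bounded (d + d') (p * q)"
  unfolding deg_bounded_def
proof
  fix m assume "m \<in> Poly_Mapping.keys (p * q)"
  then obtain g h where "m = g + h" "g \<in> Poly_Mapping.keys p" "h \<in> Poly_Mapping.keys q"
    using keys_mult[of p q] by blast
  then show "mdeg m \<le> d + d'"
    using assms by (auto simp: deg_bounded_def mdeg_add intro: add_mono)
qed

lemma deg_bounded_prod_power:
  fixes x :: "nat \<Rightarrow> 'k::field pol"
  assumes "\<And>i. i < l \<Longrightarrow> deg_bounded s (x i)"
  shows "deg_bounded (\<Sum>i<l. e i * s) (\<Prod>i<l. x i ^ e i)"
  using assms
proof (induction l)
  case (Suc l)
  have xl: "deg_bounded s (x l)" using Suc.prems by simp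
  have "deg_bounded (j * s) (x l ^ j)" for j
  proof (induction j)
    case (Suc j)
    then show ?case
      using deg_bounded_mult[OF xl] by simp
  qed (simp add: deg_bounded_def)
  then show ?case
    using Suc by (auto intro: deg_bounded_mult)
qed (simp add: deg_bounded_def)

lemma ex_deg_bounded:
  fixes x :: "nat \<Rightarrow> 'k::field pol"
  shows "\<exists>s. \<forall>i<l. deg_bounded s (x i)"
proof (intro exI allI impI)
  fix i assume i: "i < l"
  let ?D = "\<lambda>i. \<Sum>m\<in>Poly_Mapping.keys (x i). mdeg m"
  show "deg_bounded (\<Sum>i<l. ?D i) (x i)"
    unfolding deg_bounded_def
  proof
    fix m assume "m \<in> Poly_Mapping.keys (x i)"
    then have "mdeg m \<le> ?D i" by (intro member_le_sum) auto
    also have "\<dots> \<le> (\<Sum>i<l. ?D i)" by (rule member_le_sum[of i "{..<l}" ?D]) (use i in auto)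
    finally show "mdeg m \<le> (\<Sum>i<l. ?D i)" .
  qed
qed

text \<open>With \<open>w = card (V - U)\<close>, exponents below D give \<open>D ^ l\<close> power
  products of separating elements. Modulo \<open>P 0\<close> they reduce to polynomials in w
  variables whose degree is linear in D, a space of dimension of order D^w. If w < l and D is large,
  there is a non-trivial relation modulo \<open>P 0\<close>, against
  \<open>chain_algebraically_independent\<close>.\<close>

lemma prime_chain_length_le:
  fixes P :: "nat \<Rightarrow> 'k::field pol set"
  assumes V: "finite V" and prime: "\<And>i. i \<le> l \<Longrightarrow> primeideal (P i) (poly_ring V)"
    and chain: "\<And>i. i < l \<Longrightarrow> P i \<subset> P (Suc i)"
    and U: "U \<subseteq> V" "\<And>u. u \<in> U \<Longrightarrow> Poly_Mapping.single (Poly_Mapping.single u 1) 1 \<in> P 0"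
  shows "l \<le> card (V - U)"
proof (rule ccontr)
  assume "\<not> ?thesis"
  define w where "w = card (V - U)"
  then have l: "Suc w \<le> l" using \<open>\<not> _\<close> by simp
  interpret vs: vector_space "\<lambda>k p. const k * p :: 'k pol" by (rule vector_space_const_mult)
  have id: "ideal (P 0) (poly_ring V)" using prime[of 0] by (simp add: primeideal.axioms(1))
  have "\<exists>y. y \<in> P (Suc i) - P i" if "i < l" for i using chain[OF that] by blast
  then obtain x where x: "\<And>i. i < l \<Longrightarrow> x i \<in> P (Suc i) - P i" by metis
  obtain s where s: "\<And>i. i < l \<Longrightarrow> deg_bounded s (x i)" using ex_deg_bounded by blast
  \<comment> \<open>The constants make the count explicit. \<open>N\<close> bounds the degree of
    every power product, and N + 1 is at most A D. Hence the monomials number at most A^w D^w, which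
    is less than D^(w + 1) as soon as D exceeds A^w.\<close>
  define A where "A = l * s + 1"
  define D where "D = A ^ w + 1"
  define N where "N = l * (D * s)"
  \<comment> \<open>Extensional functions, so that an exponent tuple is determined by its values
    below \<open>l\<close>, as the independence lemma requires.\<close>
  define E where "E = ({..<l} \<rightarrow>\<^sub>E {..<D})"
  define S where "S = {m :: (nat \<times> nat) \<Rightarrow>\<^sub>0 nat. Poly_Mapping.keys m \<subseteq> V - U \<and> (\<forall>v. Poly_Mapping.lookup m v \<le> N)}"
  define T where "T = (\<lambda>m. Poly_Mapping.single m (1 :: 'k)) ` S"
  define y where "y e = (\<Prod>i<l. x i ^ e i)" for e :: "nat \<Rightarrow> nat"
  let ?M = "{m :: (nat \<times> nat) \<Rightarrow>\<^sub>0 nat. Poly_Mapping.keys m \<inter> U \<noteq> {}}"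
  \<comment> \<open>Monomials that involve a variable of \<open>U\<close> lie in \<open>P 0\<close>.
    Cutting them off changes \<open>y e\<close> only modulo \<open>P 0\<close> and leaves the
    variables of \<open>V - U\<close>.\<close>
  define f where "f e = restr (- ?M) (y e)" for e
  have finE: "finite E" unfolding E_def by (simp add: finite_PiE)
  have cardE: "card E = D ^ l" unfolding E_def by (simp add: card_PiE)
  have finS: "finite S" and cardS: "card S \<le> (N + 1) ^ w"
    unfolding S_def w_def using V card_bounded_monomials[of "V - U" N] by auto
  have finT: "finite T" unfolding T_def using finS by simp
  have "A * D = N + D" by (simp add: N_def A_def algebra_simps)
  then have "N + 1 \<le> A * D" by (simp add: D_def)
  have "card T \<le> (N + 1) ^ w"
    using card_image_le[OF finS, of "\<lambda>m. Poly_Mapping.single m (1 :: 'k)"] cardS by (simp add: T_def)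
  also have "\<dots> \<le> (A * D) ^ w" using \<open>N + 1 \<le> A * D\<close> by (intro power_mono) simp_all
  also have "\<dots> = A ^ w * D ^ w" by (rule power_mult_distrib)
  also have "\<dots> < D * D ^ w" by (simp add: D_def)
  also have "\<dots> = D ^ Suc w" by simp
  also have "\<dots> \<le> D ^ l" by (rule power_increasing[OF l]) (simp add: D_def)
  finally have card: "card T < card E" by (simp add: cardE)
  have yc: "y e \<in> carrier (poly_ring V)" for e
  proof -
    have xc: "x i \<in> carrier (poly_ring V)" if i: "i < l" for i
    proof -
      have "primeideal (P (Suc i)) (poly_ring V)" using prime i by simp
      then have "P (Suc i) \<subseteq> carrier (poly_ring V)"
        using ideal_poly_ringD(1) primeideal.axioms(1) by blast
      with x[OF i] show ?thesis by blast
    qed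
    interpret cring "poly_ring V :: 'k pol ring" by (rule poly_ring_cring)
    have pow: "p ^ j \<in> carrier (poly_ring V)" if "p \<in> carrier (poly_ring V)" for p :: "'k pol" and j
    proof (induction j)
      case (Suc j)
      then show ?case using m_closed[OF that Suc] by simp
    qed simp
    have "(\<Prod>i<j. x i ^ e i) \<in> carrier (poly_ring V)" if "j \<le> l" for j
      using that
    proof (induction j)
      case (Suc j)
      then have "(\<Prod>i<j. x i ^ e i) \<in> carrier (poly_ring V)" "x j ^ e j \<in> carrier (poly_ring V)"
        by (auto intro!: pow xc simp del: carrier_poly_ring)
      from m_closed[OF this] show ?case by (simp add: mult.commute)
    qed simp
    then show ?thesis unfolding y_def by blast
  qed
  have "f ` E \<subseteq> vs.span T"
  proof
    fix q assume "q \<in> f ` E"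
    then obtain e where e: "e \<in> E" "q = f e" by blast
    have "deg_bounded (\<Sum>i<l. e i * s) (y e)"
      unfolding y_def by (rule deg_bounded_prod_power[OF s])
    moreover have "(\<Sum>i<l. e i * s) \<le> (\<Sum>i<l. D * s)"
      using e(1) unfolding E_def by (intro sum_mono mult_right_mono) (auto simp: PiE_def Pi_def less_imp_le)
    ultimately have deg: "mdeg m \<le> N" if "m \<in> Poly_Mapping.keys (y e)" for m
      using that unfolding deg_bounded_def N_def by (auto dest: bspec[of _ _ m])
    have "m \<in> S" if "m \<in> Poly_Mapping.keys q" for m
    proof -
      from that have m: "m \<in> Poly_Mapping.keys (y e)" "Poly_Mapping.keys m \<inter> U = {}"
        by (simp_all add: e(2) f_def keys_restr)
      then have "Poly_Mapping.keys m \<subseteq> V - U" using yc[of e] by auto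
      moreover have "Poly_Mapping.lookup m v \<le> N" for v
        using lookup_le_mdeg[of m v] deg[OF m(1)] by (rule order_trans)
      ultimately show "m \<in> S" by (simp add: S_def)
    qed
    then have keys: "Poly_Mapping.keys q \<subseteq> S" by blast
    have "(\<Sum>m\<in>Poly_Mapping.keys q. const (Poly_Mapping.lookup q m) * Poly_Mapping.single m 1) \<in> vs.span T"
      using keys by (intro vs.span_sum vs.span_scale vs.span_base) (auto simp: T_def)
    then show "q \<in> vs.span T"
      by (simp only: single_eq_const_mult[symmetric] poly_mapping_sum_monomials[symmetric])
  qed
  from vs.exists_relation[OF finE finT card this]
  obtain k where k: "\<exists>e\<in>E. k e \<noteq> 0" "(\<Sum>e\<in>E. const (k e) * f e) = 0" by blast
  have "var_ideal V U \<subseteq> P 0" by (rule var_ideal_minimal[OF id U])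
  then have diff: "y e - f e \<in> P 0" for e
    using diff_restr_mono_ideal[OF yc[of e], of ?M] unfolding f_def var_ideal_def by blast
  have "(\<Sum>e\<in>E. const (k e) * (y e - f e)) \<in> P 0"
    by (intro ideal_sum_closed[OF id] ideal_poly_ringD(5)[OF id diff] const_in_carrier)
  also have "(\<Sum>e\<in>E. const (k e) * (y e - f e)) = (\<Sum>e\<in>E. const (k e) * y e)"
    using k(2) by (simp add: right_diff_distrib sum_subtractf)
  \<comment> \<open>The independence lemma expects non-zero coefficients only; the index set stays
    non-empty because the relation is non-trivial.\<close>
  also have "\<dots> = (\<Sum>e\<in>{e\<in>E. k e \<noteq> 0}. const (k e) * y e)"
    using finE by (intro sum.mono_neutral_right) auto
  finally have "(\<Sum>e\<in>{e\<in>E. k e \<noteq> 0}. const (k e) * (\<Prod>i<l. x i ^ e i)) \<in> P 0"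
    by (simp add: y_def)
  moreover have "(\<Sum>e\<in>{e\<in>E. k e \<noteq> 0}. const (k e) * (\<Prod>i<l. x i ^ e i)) \<notin> P 0"
  proof (rule chain_algebraically_independent[OF prime, where \<epsilon> = "\<lambda>e. e"])
    fix e e' assume "e \<in> {e\<in>E. k e \<noteq> 0}" "e' \<in> {e\<in>E. k e \<noteq> 0}" "\<And>i. i < l \<Longrightarrow> e i = e' i"
    then show "e = e'" unfolding E_def
      by (intro PiE_ext[of e "{..<l}" "\<lambda>_. {..<D}" e']) auto
  qed (use x chain k(1) finE in auto)
  ultimately show False by blast
qed

section \<open>The value of the numerator at one\<close>

text \<open>\<open>csym \<beta> p k\<close> is the complete homogeneous symmetric polynomial of degree \<open>k\<close> evaluated at
  \<open>\<beta> 1, \<dots>, \<beta> p\<close>.\<close>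

fun csym :: "(nat \<Rightarrow> nat) \<Rightarrow> nat \<Rightarrow> nat \<Rightarrow> nat"
  where
    "csym \<beta> 0 k = (if k = 0 then 1 else 0)"
  | "csym \<beta> (Suc p) 0 = 1"
  | "csym \<beta> (Suc p) (Suc k) = \<beta> (Suc p) * csym \<beta> (Suc p) k + csym \<beta> p (Suc k)"

lemma csym_0 [simp]: "csym \<beta> p 0 = 1"
  by (cases p) auto

text \<open>The pure power is one of the monomials in the complete symmetric sum, and the others are
  non-negative.\<close>

lemma csym_ge: "j \<in> {1..p} \<Longrightarrow> \<beta> j ^ k \<le> csym \<beta> p k"
proof (induction \<beta> p k rule: csym.induct)
  case (3 \<beta> p k)
  show ?case
  proof (cases "j = Suc p")
    case True
    then have "\<beta> j ^ k \<le> csym \<beta> (Suc p) k" using 3 by simp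
    then have "\<beta> j ^ Suc k \<le> \<beta> (Suc p) * csym \<beta> (Suc p) k"
      using True by simp
    then show ?thesis by simp
  next
    case False
    then have "\<beta> j ^ Suc k \<le> csym \<beta> p (Suc k)" using 3 by simp
    then show ?thesis by simp
  qed
qed auto

text \<open>There are at most (k + 1)^p monomials of degree k in p variables, each of value at most
  B^k. The recursion reproduces this count.\<close>

lemma csym_le:
  assumes "\<And>j. j \<in> {1..p} \<Longrightarrow> \<beta> j \<le> B"
  shows "csym \<beta> p k \<le> (k + 1) ^ p * B ^ k"
  using assms
proof (induction \<beta> p k rule: csym.induct)
  case (3 \<beta> p k)
  have 1: "csym \<beta> (Suc p) k \<le> (k + 1) ^ Suc p * B ^ k" using 3 by blast
  have 2: "csym \<beta> p (Suc k) \<le> (Suc k + 1) ^ p * B ^ Suc k" using 3 by simp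
  have "\<beta> (Suc p) \<le> B" using 3 by simp
  then have "csym \<beta> (Suc p) (Suc k) \<le> B * ((k + 1) ^ Suc p * B ^ k) + (Suc k + 1) ^ p * B ^ Suc k"
    using mult_mono[OF _ 1, of "\<beta> (Suc p)" B] 2 by simp
  also have "\<dots> = ((k + 1) ^ p * (k + 1) + (Suc k + 1) ^ p) * B ^ Suc k"
    by (simp add: algebra_simps)
  also have "\<dots> \<le> ((Suc k + 1) ^ p * (k + 1) + (Suc k + 1) ^ p) * B ^ Suc k"
    by (intro mult_right_mono add_right_mono power_mono) auto
  also have "\<dots> = (Suc k + 1) ^ Suc p * B ^ Suc k"
    by (simp add: algebra_simps)
  finally show ?case .
qed auto

text \<open>In the recursion the term that keeps the word gains a factor 1 - x from 1 - x^b, while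
  the term that shortens the word already has one factor more. The cofactor 1 + x + ... + x^(b-1)
  has value b at 1, which turns the recursion of \<open>numer\<close> into that of
  \<open>csym\<close>.\<close>

lemma numer_factor:
  "1 \<le> p \<Longrightarrow> p \<le> n + 1 \<Longrightarrow>
    \<exists>Q. numer \<beta> p n = (1 - [:0, 1:]) ^ (n + 1 - p) * Q \<and> poly Q 1 = int (csym \<beta> p (n + 1 - p))"
proof (induction \<beta> p n rule: numer.induct)
  case (3 \<beta> p n)
  let ?x = "[:0, 1:] :: int poly"
  have dec: "1 - ?x ^ b = (1 - ?x) * (\<Sum>i<b. ?x ^ i)" for b
    by (rule one_diff_power_eq)
  have val: "poly (\<Sum>i<b. ?x ^ i) 1 = int b" for b
    by (simp add: poly_sum poly_power)
  let ?b = "\<beta> (Suc p)"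
  show ?case
  proof (cases "p = Suc n")
    \<comment> \<open>The word is one letter longer than the number of columns. No factor is
      claimed, and at 1 the term with 1 - x^b vanishes, leaving the value 1 of the shorter
      word.\<close>
    case True
    then have "1 \<le> p" "p \<le> n + 1" by auto
    with 3 obtain Q where Q: "numer \<beta> p n = (1 - ?x) ^ (n + 1 - p) * Q" "poly Q 1 = int (csym \<beta> p (n + 1 - p))"
      by blast
    then show ?thesis
      using True by (intro exI[of _ "numer \<beta> (Suc p) (Suc n)"]) simp
  next
    case False
    then have le: "p \<le> n" using 3 by simp
    then obtain Q where Q: "numer \<beta> (Suc p) n = (1 - ?x) ^ (n - p) * Q"
      "poly Q 1 = int (csym \<beta> (Suc p) (n - p))"
      using "3.IH"(1) by auto
    obtain Q' where Q': "numer \<beta> p n = (1 - ?x) ^ Suc (n - p) * Q'"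
      "poly Q' 1 = int (csym \<beta> p (Suc (n - p)))"
    proof (cases "p = 0")
      case True
      \<comment> \<open>The empty word has numerator 0, in accordance with the complete symmetric
        polynomial of positive degree in no variables.\<close>
      then show ?thesis using that[of 0] by simp
    next
      case False
      then show ?thesis using "3.IH"(2) le that by (auto simp: Suc_diff_le)
    qed
    have ring_eq: "(u * s) * (v * q) + x * ((u * v) * q') = (u * v) * (s * q + x * q')"
      for u s v q x q' :: "int poly"
      by (simp add: algebra_simps)
    have "numer \<beta> (Suc p) (Suc n) = (1 - ?x) ^ Suc (n - p) * ((\<Sum>i<?b. ?x ^ i) * Q + ?x ^ ?b * Q')"
      unfolding numer.simps Q(1) Q'(1) dec power_Suc by (rule ring_eq)
    moreover have "poly ((\<Sum>i<?b. ?x ^ i) * Q + ?x ^ ?b * Q') 1 = int (csym \<beta> (Suc p) (Suc (n - p)))"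
      by (simp add: val Q Q' poly_power)
    ultimately show ?thesis
      using le by (auto simp: Suc_diff_le)
  qed
qed auto

section \<open>The degree from the Hilbert series, and the growth of its values\<close>

text \<open>Two representations of the series have numerators that differ by a power of 1 - x. As
  neither vanishes at 1, that power is trivial, so the description in \<open>ideal_deg\<close>
  determines a single value.\<close>

lemma ideal_deg_eqI:
  assumes f: "hilbert_series V J * (1 - fps_X) ^ d = fps_of_poly f" and f1: "poly f 1 \<noteq> 0"
  shows "ideal_deg V J = poly f 1"
  unfolding ideal_deg_def
proof (rule the_equality)
  show "\<exists>f' d'. hilbert_series V J * (1 - fps_X) ^ d' = fps_of_poly f' \<and> poly f' 1 \<noteq> 0 \<and> poly f 1 = poly f' 1"
    using assms by blast
next
  have unique: "g = h"
    if "hilbert_series V J * (1 - fps_X) ^ d = fps_of_poly g" "poly g 1 \<noteq> 0"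
      "hilbert_series V J * (1 - fps_X) ^ e = fps_of_poly h" "poly h 1 \<noteq> 0" "d \<le> e" for g h d e
  proof -
    have "fps_of_poly h = fps_of_poly g * (1 - fps_X) ^ (e - d)"
      using that(5) unfolding that(1)[symmetric] that(3)[symmetric]
      by (simp only: mult.assoc power_add[symmetric] le_add_diff_inverse)
    also have "\<dots> = fps_of_poly (g * (1 - [:0, 1:]) ^ (e - d))"
      by (simp add: fps_of_poly_mult fps_of_poly_power fps_of_poly_diff)
    finally have h: "h = g * (1 - [:0, 1:]) ^ (e - d)"
      by (simp only: fps_of_poly_eq_iff)
    with that(4) have "e - d = 0"
      by (cases "e - d") (auto simp: poly_power)
    with h show ?thesis by simp
  qed
  fix e assume "\<exists>f' d'. hilbert_series V J * (1 - fps_X) ^ d' = fps_of_poly f' \<and> poly f' 1 \<noteq> 0 \<and> e = poly f' 1"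
  then obtain f' d' where f': "hilbert_series V J * (1 - fps_X) ^ d' = fps_of_poly f'" "poly f' 1 \<noteq> 0" "e = poly f' 1"
    by blast
  show "e = poly f 1"
    using unique[OF f f1 f'(1,2)] unique[OF f'(1,2) f f1] f'(3) by (cases "d \<le> d'") auto
qed

text \<open>The values lie between a constant times B^n and a fixed power of 2n times B^n, and the
  n-th roots of constants and of n tend to 1.\<close>

lemma root_csym_limit:
  assumes le: "\<And>j. j \<in> {1..p} \<Longrightarrow> \<beta> j \<le> B" and j: "j \<in> {1..p}" "\<beta> j = B" and B: "1 \<le> B"
  shows "(\<lambda>n. root n (real (csym \<beta> p (n + 1 - p)))) \<longlonglongrightarrow> real B"
proof (rule tendsto_sandwich)
  have lo: "(real B) ^ n / (real B) ^ p \<le> real (csym \<beta> p (n + 1 - p))" for n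
  proof -
    \<comment> \<open>The difference is truncated for small n, but the exponent on the right is at
      least n in every case.\<close>
    have "real B ^ n \<le> real B ^ (p + (n + 1 - p))"
      by (rule power_increasing) (use B in auto)
    then have "real B ^ n / real B ^ p \<le> real B ^ (n + 1 - p)"
      using B by (simp add: power_add field_simps)
    also have "\<dots> = real (B ^ (n + 1 - p))" by simp
    also have "\<dots> \<le> real (csym \<beta> p (n + 1 - p))"
      using csym_ge[OF j(1), of \<beta> "n + 1 - p"] j(2) by (simp only: of_nat_le_iff)
    finally show ?thesis .
  qed
  have hi: "real (csym \<beta> p (n + 1 - p)) \<le> (2 * real n) ^ p * real B ^ n" if n: "1 \<le> n" for n
  proof -
    have p: "1 \<le> p" using j by simp
    have "csym \<beta> p (n + 1 - p) \<le> (n + 1 - p + 1) ^ p * B ^ (n + 1 - p)"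
      by (rule csym_le) (rule le)
    \<comment> \<open>As p and n are at least 1, the base on the left is at most n + 1, hence at
      most 2n.\<close>
    also have "\<dots> \<le> (2 * n) ^ p * B ^ n"
      using n p B by (intro mult_mono power_mono power_increasing) auto
    finally have "real (csym \<beta> p (n + 1 - p)) \<le> real ((2 * n) ^ p * B ^ n)"
      by (simp only: of_nat_le_iff)
    then show ?thesis by simp
  qed
  show "\<forall>\<^sub>F n in sequentially. real B / root n (real B ^ p) \<le> root n (real (csym \<beta> p (n + 1 - p)))"
    using eventually_ge_at_top[of 1]
  proof eventually_elim
    case (elim n)
    have "root n (real B ^ n / real B ^ p) \<le> root n (real (csym \<beta> p (n + 1 - p)))"
      using elim lo by simp
    then show ?case
      using elim by (simp add: real_root_divide real_root_power_cancel)
  qed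
  show "\<forall>\<^sub>F n in sequentially. root n (real (csym \<beta> p (n + 1 - p))) \<le> (root n 2 * root n (real n)) ^ p * real B"
    using eventually_ge_at_top[of 1]
  proof eventually_elim
    case (elim n)
    have "root n (real (csym \<beta> p (n + 1 - p))) \<le> root n ((2 * real n) ^ p * real B ^ n)"
      using elim hi by simp
    then show ?case
      using elim by (simp add: real_root_mult real_root_power_cancel real_root_power power_mult_distrib)
  qed
  have "(\<lambda>n. real B / root n (real B ^ p)) \<longlonglongrightarrow> real B / 1"
    using B by (intro tendsto_intros LIMSEQ_root_const) auto
  then show "(\<lambda>n. real B / root n (real B ^ p)) \<longlonglongrightarrow> real B" by simp
  have "(\<lambda>n. (root n 2 * root n (real n)) ^ p * real B) \<longlonglongrightarrow> (1 * 1) ^ p * real B"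
    by (intro tendsto_intros LIMSEQ_root_const LIMSEQ_root) auto
  then show "(\<lambda>n. (root n 2 * root n (real n)) ^ p * real B) \<longlonglongrightarrow> real B" by simp
qed

section \<open>The orbit ideal of a monomial\<close>

definition expo :: "nat \<Rightarrow> nat \<Rightarrow> (nat \<Rightarrow> nat \<Rightarrow> nat) \<Rightarrow> (nat \<times> nat) \<Rightarrow>\<^sub>0 nat"
  where "expo c s a = (\<Sum>i=1..c. \<Sum>j=1..s. Poly_Mapping.single (i, j) (a i j))"

text \<open>The action of \<open>inc_act\<close> on exponent vectors: its product over the variables
  of a monomial becomes a sum.\<close>

definition shift :: "(nat \<Rightarrow> nat) \<Rightarrow> ((nat \<times> nat) \<Rightarrow>\<^sub>0 nat) \<Rightarrow> (nat \<times> nat) \<Rightarrow>\<^sub>0 nat"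
  where "shift \<pi> e = (\<Sum>(i, j) \<in> Poly_Mapping.keys e. Poly_Mapping.single (i, \<pi> j) (Poly_Mapping.lookup e (i, j)))"

lemma lookup_expo:
  "Poly_Mapping.lookup (expo c s a) (i, j) = (if i \<in> {1..c} \<and> j \<in> {1..s} then a i j else 0)"
proof -
  have "Poly_Mapping.lookup (expo c s a) (i, j) =
      (\<Sum>i'=1..c. \<Sum>j'=1..s. if i' = i then (if j' = j then a i j else 0) else 0)"
    unfolding expo_def lookup_sum by (intro sum.cong) (auto simp: lookup_single when_def)
  also have "\<dots> = (\<Sum>i'=1..c. if i' = i then (\<Sum>j'=1..s. if j' = j then a i j else 0) else 0)"
    by (intro sum.cong) auto
  finally show ?thesis by simp
qed

lemma keys_expo: "Poly_Mapping.keys (expo c s a) \<subseteq> {1..c} \<times> {1..s}"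
proof
  fix v assume "v \<in> Poly_Mapping.keys (expo c s a)"
  then show "v \<in> {1..c} \<times> {1..s}"
    by (cases v) (auto simp: in_keys_iff lookup_expo split: if_splits)
qed

lemma var_power: "var i j ^ n = Poly_Mapping.single (Poly_Mapping.single (i, j) n) 1"
  by (induction n) (auto simp: var_def mult_single single_add[symmetric])

lemma prod_monomials:
  "(\<Prod>x\<in>A. Poly_Mapping.single (f x) 1) = (Poly_Mapping.single (\<Sum>x\<in>A. f x) 1 :: 'k::field pol)"
  by (induction A rule: infinite_finite_induct) (auto simp: mult_single)

lemma prod_var_eq_expo:
  "(\<Prod>i=1..c. \<Prod>j=1..s. var i j ^ a i j) = (Poly_Mapping.single (expo c s a) 1 :: 'k::field pol)"
  by (simp add: var_power prod_monomials expo_def)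

lemma inc_act_monomial:
  "inc_act \<pi> (Poly_Mapping.single e 1) = (Poly_Mapping.single (shift \<pi> e) 1 :: 'k::field pol)"
  by (simp add: inc_act_def var_power split_def prod_monomials shift_def)

text \<open>An element of \<open>Inc\<close> is injective on the positive integers, so no two
  columns of the matrix are added up in the image.\<close>

lemma lookup_shift_expo:
  assumes \<pi>: "\<pi> \<in> Inc"
  shows "j \<in> {1..s} \<Longrightarrow> i \<in> {1..c} \<Longrightarrow> Poly_Mapping.lookup (shift \<pi> (expo c s a)) (i, \<pi> j) = a i j"
    and "k \<notin> \<pi> ` {1..s} \<or> i \<notin> {1..c} \<Longrightarrow> Poly_Mapping.lookup (shift \<pi> (expo c s a)) (i, k) = 0"
proof -
  let ?e = "expo c s a"
  have eq: "Poly_Mapping.lookup (shift \<pi> ?e) (i, k) =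
      (\<Sum>v\<in>Poly_Mapping.keys ?e. if fst v = i \<and> \<pi> (snd v) = k then Poly_Mapping.lookup ?e v else 0)" for i k
    unfolding shift_def lookup_sum split_def
    by (intro sum.cong) (auto simp: lookup_single when_def)
  show "Poly_Mapping.lookup (shift \<pi> ?e) (i, k) = 0" if "k \<notin> \<pi> ` {1..s} \<or> i \<notin> {1..c}"
    unfolding eq
  proof (intro sum.neutral ballI if_not_P notI)
    fix v assume v: "v \<in> Poly_Mapping.keys ?e" "fst v = i \<and> \<pi> (snd v) = k"
    then have "fst v \<in> {1..c}" "snd v \<in> {1..s}" using keys_expo[of c s a] by auto
    with v(2) that show False by blast
  qed
  assume ij: "j \<in> {1..s}" "i \<in> {1..c}"
  have inj: "j' = j" if "j' \<in> {1..s}" "\<pi> j' = \<pi> j" for j'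
  proof (cases j j' rule: linorder_cases)
    case less
    with Inc_less[OF \<pi>, of j j'] ij that show ?thesis by simp
  next
    case greater
    with Inc_less[OF \<pi>, of j' j] that show ?thesis by simp
  qed simp
  have "Poly_Mapping.lookup (shift \<pi> ?e) (i, \<pi> j) =
      (\<Sum>v\<in>Poly_Mapping.keys ?e. if v = (i, j) then Poly_Mapping.lookup ?e v else 0)"
    unfolding eq
  proof (intro sum.cong if_cong)
    fix v assume "v \<in> Poly_Mapping.keys ?e"
    then have "snd v \<in> {1..s}" using keys_expo[of c s a] by auto
    then show "(fst v = i \<and> \<pi> (snd v) = \<pi> j) = (v = (i, j))"
      using inj[of "snd v"] by (cases v) auto
  qed simp_all
  also have "\<dots> = Poly_Mapping.lookup ?e (i, j)"
    by (simp add: in_keys_iff)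
  finally show "Poly_Mapping.lookup (shift \<pi> ?e) (i, \<pi> j) = a i j"
    using ij by (simp add: lookup_expo)
qed

lemma shift_expo_divides_iff:
  assumes \<pi>: "\<pi> \<in> Inc"
  shows "(\<exists>h. m = shift \<pi> (expo c s a) + h) \<longleftrightarrow>
    (\<forall>j\<in>{1..s}. \<forall>i\<in>{1..c}. a i j \<le> Poly_Mapping.lookup m (i, \<pi> j))"
proof
  assume "\<exists>h. m = shift \<pi> (expo c s a) + h"
  then obtain h where h: "m = shift \<pi> (expo c s a) + h" by blast
  show "\<forall>j\<in>{1..s}. \<forall>i\<in>{1..c}. a i j \<le> Poly_Mapping.lookup m (i, \<pi> j)"
  proof (intro ballI)
    fix j i assume "j \<in> {1..s}" "i \<in> {1..c}"
    from lookup_shift_expo(1)[OF \<pi> this, of a]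
    show "a i j \<le> Poly_Mapping.lookup m (i, \<pi> j)" by (simp add: h lookup_add)
  qed
next
  assume le: "\<forall>j\<in>{1..s}. \<forall>i\<in>{1..c}. a i j \<le> Poly_Mapping.lookup m (i, \<pi> j)"
  let ?u = "shift \<pi> (expo c s a)"
  have "Poly_Mapping.lookup ?u (i, k) \<le> Poly_Mapping.lookup m (i, k)" for i k
  proof (cases "k \<in> \<pi> ` {1..s} \<and> i \<in> {1..c}")
    case True
    then obtain j where "j \<in> {1..s}" "k = \<pi> j" "i \<in> {1..c}" by blast
    with lookup_shift_expo(1)[OF \<pi>, of j s i c a] le show ?thesis by simp
  next
    case False
    then show ?thesis using lookup_shift_expo(2)[OF \<pi>, of k s i c a] by simp
  qed
  then have "Poly_Mapping.lookup m v = Poly_Mapping.lookup (?u + (m - ?u)) v" for v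
    by (cases v) (simp add: lookup_add lookup_minus)
  then have "m = ?u + (m - ?u)" by (rule poly_mapping_eqI)
  then show "\<exists>h. m = ?u + h" by (rule exI)
qed

lemma keys_shift_expo:
  assumes \<pi>: "\<pi> \<in> Inc"
  shows "Poly_Mapping.keys (shift \<pi> (expo c s a)) \<subseteq> {1..c} \<times> {1..}"
proof
  fix v assume v: "v \<in> Poly_Mapping.keys (shift \<pi> (expo c s a))"
  obtain i k where ik: "v = (i, k)" by (cases v)
  have "k \<in> \<pi> ` {1..s} \<and> i \<in> {1..c}"
  proof (rule ccontr)
    assume "\<not> ?thesis"
    then have "Poly_Mapping.lookup (shift \<pi> (expo c s a)) (i, k) = 0"
      by (intro lookup_shift_expo(2)[OF \<pi>]) blast
    with v show False by (simp add: ik in_keys_iff)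
  qed
  then obtain j where j: "j \<in> {1..s}" "k = \<pi> j" "i \<in> {1..c}" by blast
  then have "1 \<le> k" using \<pi> by (simp add: Inc_def)
  with j(3) show "v \<in> {1..c} \<times> {1..}" by (simp add: ik)
qed

lemma trunc_orbit_ideal:
  fixes I :: "'k::field pol set"
  assumes I: "I = orbit_ideal c (\<Prod>i=1..c. \<Prod>j=1..s. var i j ^ a i j)"
    and last: "\<exists>i\<in>{1..c}. a i s \<noteq> 0" and s: "1 \<le> s"
  shows "trunc c I n = mono_ideal ({1..c} \<times> {1..n}) {m. emb c a s n m}"
proof -
  let ?e = "expo c s a"
  have gens: "{inc_act \<pi> (Poly_Mapping.single ?e 1) | \<pi>. \<pi> \<in> Inc} =
      ((\<lambda>g. Poly_Mapping.single g 1) ` {shift \<pi> ?e | \<pi>. \<pi> \<in> Inc} :: 'k pol set)"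
    by (auto simp: inc_act_monomial)
  have "I = mono_ideal ({1..c} \<times> {1..}) {g + h | g h. g \<in> {shift \<pi> ?e | \<pi>. \<pi> \<in> Inc}}"
    unfolding I orbit_ideal_def prod_var_eq_expo gens
    by (rule genideal_monomials) (use keys_shift_expo in blast)
  also have "{g + h | g h. g \<in> {shift \<pi> ?e | \<pi>. \<pi> \<in> Inc}} =
      {m. \<exists>\<pi>\<in>Inc. \<forall>j\<in>{1..s}. \<forall>i\<in>{1..c}. a i j \<le> Poly_Mapping.lookup m (i, \<pi> j)}" (is "_ = ?M")
    using shift_expo_divides_iff[of _ _ c s a] by blast
  finally have I_eq: "I = mono_ideal ({1..c} \<times> {1..}) ?M" .
  have M: "m \<in> ?M \<longleftrightarrow> emb c a s n m" if m: "Poly_Mapping.keys m \<subseteq> {1..c} \<times> {1..n}" for m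
  proof
    assume "m \<in> ?M"
    then obtain \<pi> where \<pi>: "\<pi> \<in> Inc" "\<forall>j\<in>{1..s}. \<forall>i\<in>{1..c}. a i j \<le> Poly_Mapping.lookup m (i, \<pi> j)"
      by blast
    \<comment> \<open>A non-zero entry of the last column forces \<open>m\<close> to involve a
      variable of column \<open>\<pi> s\<close>. So this column is at most n, and by monotonicity
      all columns used are.\<close>
    obtain i where i: "i \<in> {1..c}" "a i s \<noteq> 0" using last by blast
    then have "Poly_Mapping.lookup m (i, \<pi> s) \<noteq> 0" using \<pi>(2) s by force
    then have "(i, \<pi> s) \<in> Poly_Mapping.keys m" by (simp only: in_keys_iff not_False_eq_True)
    then have le: "\<pi> s \<le> n" using m by auto
    have "\<pi> j \<le> n" if "j \<in> {1..s}" for j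
      using Inc_less[OF \<pi>(1), of j s] le that by (cases "j = s") auto
    with \<pi> show "emb c a s n m" unfolding emb_iff by blast
  next
    assume "emb c a s n m"
    then show "m \<in> ?M" unfolding emb_iff by blast
  qed
  have "p \<in> trunc c I n \<longleftrightarrow> p \<in> mono_ideal ({1..c} \<times> {1..n}) {m. emb c a s n m}" for p :: "'k pol"
  proof (cases "p \<in> carrier (KXn c n)")
    case True
    then have "\<forall>m\<in>Poly_Mapping.keys p. m \<in> ?M \<longleftrightarrow> emb c a s n m"
      using M by (metis (mono_tags, lifting) carrier_poly_ring mem_Collect_eq)
    then have "Poly_Mapping.keys p \<subseteq> ?M \<longleftrightarrow> Poly_Mapping.keys p \<subseteq> {m. emb c a s n m}"
      by blast
    moreover have "p \<in> carrier (KX c)"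
      using True by (auto 4 3)
    ultimately show ?thesis
      using True unfolding trunc_def I_eq mono_ideal_def by blast
  next
    case False
    then show ?thesis unfolding trunc_def mono_ideal_def by blast
  qed
  then show ?thesis by blast
qed

lemma up_closed_emb: "up_closed {m. emb c a p n m}"
  unfolding up_closed_def emb_iff by (auto simp: lookup_add intro: trans_le_add1)

text \<open>In other words, 1 is not in the truncated ideal, as the computation of its Hilbert
  function requires.\<close>

lemma not_emb_zero:
  assumes "\<exists>i\<in>{1..c}. a i s \<noteq> 0" "1 \<le> s"
  shows "\<not> emb c a s n 0"
  using assms unfolding emb_iff by force

section \<open>The Krull dimension of the truncations\<close>

text \<open>A column of \<open>C\<close> fits every letter, so only the number of such columns
  matters and not their position.\<close>

lemma emb_of_dominating_columns:
  assumes "\<forall>k\<in>C. \<forall>i\<in>{1..c}. \<forall>j\<in>{1..p}. a i j \<le> Poly_Mapping.lookup m (i, k)"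
    and "p \<le> card (C \<inter> {1..n})"
  shows "emb c a p n m"
  using assms
proof (induction c a p n m rule: emb.induct)
  case (3 c a p n m)
  have eq: "{1..Suc n} = insert (Suc n) {1..n}" by auto
  show ?case
  proof (cases "\<forall>i\<in>{1..c}. a i (Suc p) \<le> Poly_Mapping.lookup m (i, Suc n)")
    case True
    have "card (C \<inter> {1..Suc n}) \<le> Suc (card (C \<inter> {1..n}))"
      unfolding eq by (simp add: Int_insert_right card_insert_if)
    then have "p \<le> card (C \<inter> {1..n})" using "3.prems"(2) by linarith
    then have "emb c a p n m"
      using "3.IH"(1)[OF True] "3.prems"(1) by simp
    then show ?thesis using True by simp
  next
    case False
    then have "Suc n \<notin> C" using "3.prems"(1) by auto
    then have "Suc p \<le> card (C \<inter> {1..n})" using "3.prems"(2) unfolding eq by simp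
    then have "emb c a (Suc p) n m"
      using "3.IH"(2)[OF False] "3.prems"(1) by blast
    then show ?thesis unfolding emb.simps by (subst if_not_P[OF False])
  qed
qed auto

text \<open>Variables are split off one at a time. The process cannot end with the monomial 1, which
  lies in no prime ideal.\<close>

lemma variable_of_monomial_in_prime:
  fixes P :: "'k::field pol set"
  assumes P: "primeideal P (poly_ring V)"
  shows "Poly_Mapping.keys m \<subseteq> V \<Longrightarrow> Poly_Mapping.single m 1 \<in> P \<Longrightarrow>
    \<exists>v\<in>Poly_Mapping.keys m. Poly_Mapping.single (Poly_Mapping.single v 1) 1 \<in> P"
proof (induction "mdeg m" arbitrary: m rule: less_induct)
  case less
  interpret primeideal P "poly_ring V :: 'k pol ring" by (rule P)
  show ?case
  proof (cases "m = 0")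
    case True
    then have "1 \<in> P" using less.prems by simp
    then show ?thesis using one_imp_carrier I_notcarr by simp
  next
    case False
    then obtain v where v: "v \<in> Poly_Mapping.keys m" by (metis ex_in_conv keys_eq_empty)
    define h where "h = m - Poly_Mapping.single v 1"
    have m: "m = Poly_Mapping.single v 1 + h"
      using v unfolding h_def
      by (intro poly_mapping_eqI) (auto simp: lookup_add lookup_minus lookup_single when_def in_keys_iff)
    have deg: "mdeg h < mdeg m" by (simp add: m mdeg_add)
    have keys: "Poly_Mapping.keys h \<subseteq> Poly_Mapping.keys m" by (subst m) (auto simp: keys_add_nat)
    have "Poly_Mapping.single (Poly_Mapping.single v 1) 1 * Poly_Mapping.single h 1 \<in> P"
      using less.prems(2) by (subst (asm) m) (simp add: mult_single)
    then have "Poly_Mapping.single (Poly_Mapping.single v 1) 1 \<in> P \<or> Poly_Mapping.single h 1 \<in> P"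
      using I_prime[of "Poly_Mapping.single (Poly_Mapping.single v 1) 1" "Poly_Mapping.single h 1"]
        v keys less.prems(1) by auto
    then show ?thesis
      using v less.hyps[OF deg] keys less.prems(1) by blast
  qed
qed

lemma krull_dim_trunc_bounds:
  fixes I :: "'k::field pol set"
  assumes c: "1 \<le> c" and I: "I = orbit_ideal c (\<Prod>i=1..c. \<Prod>j=1..s. var i j ^ a i j)"
    and last: "\<exists>i\<in>{1..c}. a i s \<noteq> 0" and s: "1 \<le> s"
  shows "enat ((c - 1) * n) \<le> krull_dim (KXn c n Quot trunc c I n)"
    and "krull_dim (KXn c n Quot trunc c I n) \<le> enat ((c - 1) * n + s)"
proof -
  let ?V = "{1..c} \<times> {1..n}" and ?M = "{m. emb c a s n m}"
  interpret cring "poly_ring ?V :: 'k pol ring" by (rule poly_ring_cring)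
  have J: "trunc c I n = mono_ideal ?V ?M" by (rule trunc_orbit_ideal[OF I last s])
  have id: "ideal (trunc c I n) (poly_ring ?V)"
    unfolding J by (rule ideal_mono_ideal[OF up_closed_emb])
  have V: "finite ?V" "card ?V = c * n" by (simp_all add: card_cartesian_product)
  show "enat ((c - 1) * n) \<le> krull_dim (KXn c n Quot trunc c I n)"
  proof -
    obtain i where i: "i \<in> {1..c}" "a i s \<noteq> 0" using last by blast
    let ?U = "{i} \<times> {1..n}"
    have U: "?U \<subseteq> ?V" using i by auto
    have "Poly_Mapping.keys m \<inter> ?U \<noteq> {}" if "emb c a s n m" for m
    proof -
      obtain \<pi> where \<pi>: "\<pi> \<in> Inc" "\<pi> s \<le> n" "a i s \<le> Poly_Mapping.lookup m (i, \<pi> s)"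
        using \<open>emb c a s n m\<close> s i(1) unfolding emb_iff by auto
      have "1 \<le> \<pi> s" using \<pi>(1) s by (simp add: Inc_def)
      then have "(i, \<pi> s) \<in> Poly_Mapping.keys m \<inter> ?U"
        using \<pi> i by (auto simp: in_keys_iff)
      then show ?thesis by blast
    qed
    then have "trunc c I n \<subseteq> var_ideal ?V ?U"
      unfolding J var_ideal_def mono_ideal_def by blast
    from krull_dim_quot_ge[OF V(1) U id this]
    have "enat (card (?V - ?U)) \<le> krull_dim (KXn c n Quot trunc c I n)" .
    moreover have "card (?V - ?U) = (c - 1) * n"
      using card_Diff_subset[of ?U ?V] U V by (simp add: card_cartesian_product diff_mult_distrib)
    ultimately show ?thesis by simp
  qed
  show "krull_dim (KXn c n Quot trunc c I n) \<le> enat ((c - 1) * n + s)"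
    unfolding krull_dim_quot[OF id]
  proof (rule Sup_least)
    fix d assume "d \<in> {enat l | l. \<exists>P. (\<forall>i\<le>l. primeideal (P i) (poly_ring ?V) \<and> trunc c I n \<subseteq> P i) \<and> (\<forall>i<l. P i \<subset> P (Suc i))}"
    then obtain l P where l: "d = enat l" and P: "\<And>i. i \<le> l \<Longrightarrow> primeideal (P i) (poly_ring ?V)"
      "trunc c I n \<subseteq> P 0" "\<And>i. i < l \<Longrightarrow> P i \<subset> P (Suc i)"
      by auto
    define U where "U = {v \<in> ?V. Poly_Mapping.single (Poly_Mapping.single v 1) (1 :: 'k) \<in> P 0}"
    \<comment> \<open>The columns none of whose variables lies in \<open>P 0\<close>. If there were
      \<open>s\<close> of them, they would carry a monomial of the truncated ideal.\<close>
    define C where "C = {1..n} - snd ` U"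
    have "card C < s"
    proof (rule ccontr)
      assume "\<not> card C < s"
      define A where "A = (\<Sum>i=1..c. \<Sum>j=1..s. a i j)"
      have A: "a i j \<le> A" if "i \<in> {1..c}" "j \<in> {1..s}" for i j
      proof -
        have "a i j \<le> (\<Sum>j=1..s. a i j)" using that by (intro member_le_sum) auto
        also have "\<dots> \<le> A" unfolding A_def
          by (rule member_le_sum[of i "{1..c}" "\<lambda>i. \<Sum>j=1..s. a i j"]) (use that in auto)
        finally show ?thesis .
      qed
      \<comment> \<open>All variables in the columns of \<open>C\<close>, raised to a power
        \<open>A\<close> that dominates every entry of the matrix. As \<open>m\<close> lies in
        \<open>P 0\<close>, so does one of its variables, contrary to the choice of
        \<open>C\<close>.\<close>
      define m where "m = (\<Sum>v\<in>{1..c} \<times> C. Poly_Mapping.single v A)"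
      have finC: "finite ({1..c} \<times> C)" unfolding C_def by simp
      have lookup: "Poly_Mapping.lookup m v = (if v \<in> {1..c} \<times> C then A else 0)" for v
        unfolding m_def lookup_sum using finC by (simp add: lookup_single when_def)
      then have keys: "Poly_Mapping.keys m \<subseteq> {1..c} \<times> C"
        by (auto simp: in_keys_iff split: if_splits)
      then have keysV: "Poly_Mapping.keys m \<subseteq> ?V" unfolding C_def by blast
      have "C \<inter> {1..n} = C" unfolding C_def by blast
      then have "emb c a s n m"
        using \<open>\<not> card C < s\<close> A by (intro emb_of_dominating_columns[of C]) (auto simp: lookup)
      then have "Poly_Mapping.single m 1 \<in> trunc c I n"
        using keysV unfolding J mono_ideal_def by simp
      then have "Poly_Mapping.single m 1 \<in> P 0" using P(2) by blast
      then obtain v where v: "v \<in> Poly_Mapping.keys m" "Poly_Mapping.single (Poly_Mapping.single v 1) 1 \<in> P 0"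
        using variable_of_monomial_in_prime[OF P(1)[of 0] keysV] by auto
      then have "snd v \<in> snd ` U" using keysV unfolding U_def by blast
      moreover have "snd v \<in> C" using v(1) keys by auto
      ultimately show False unfolding C_def by blast
    qed
    moreover have finU: "finite U" unfolding U_def by simp
    have "snd ` U \<subseteq> {1..n}" unfolding U_def by auto
    then have "card C = n - card (snd ` U)" "card (snd ` U) \<le> n"
      unfolding C_def using finU card_mono[of "{1..n}" "snd ` U"] by (auto simp: card_Diff_subset)
    moreover have "card (snd ` U) \<le> card U" by (rule card_image_le[OF finU])
    \<comment> \<open>Every column outside \<open>C\<close> provides at least one variable of
      \<open>U\<close>. The loss of at most \<open>s\<close> columns disappears after division by
      n.\<close>
    ultimately have "n \<le> card U + s" by linarith
    moreover have "l \<le> card (?V - U)"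
    proof (rule prime_chain_length_le[of ?V l P U])
      show "primeideal (P i) (poly_ring ?V)" if "i \<le> l" for i by (rule P(1)[OF that])
      show "P i \<subset> P (Suc i)" if "i < l" for i by (rule P(3)[OF that])
    qed (auto simp: U_def)
    moreover have "card (?V - U) = c * n - card U"
      using V finU by (subst card_Diff_subset) (auto simp: U_def)
    moreover have "c * n = (c - 1) * n + n" using c by (cases c) auto
    ultimately have "l \<le> (c - 1) * n + s" by linarith
    then show "d \<le> enat ((c - 1) * n + s)" by (simp add: l)
  qed
qed

section \<open>The degree of the truncations\<close>

lemma ideal_deg_trunc:
  fixes I :: "'k::field pol set"
  assumes c: "1 \<le> c" and I: "I = orbit_ideal c (\<Prod>i=1..c. \<Prod>j=1..s. var i j ^ a i j)"
    and last: "\<exists>i\<in>{1..c}. a i s \<noteq> 0" and s: "1 \<le> s" and n: "s \<le> n"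
  shows "ideal_deg ({1..c} \<times> {1..n}) (trunc c I n) = int (csym (\<lambda>j. \<Sum>i=1..c. a i j) s (n + 1 - s))"
proof -
  let ?V = "{1..c} \<times> {1..n}" and ?\<beta> = "\<lambda>j. \<Sum>i=1..c. a i j" and ?x = "[:0, 1:] :: int poly"
  obtain Q where Q: "numer ?\<beta> s n = (1 - ?x) ^ (n + 1 - s) * Q" "poly Q 1 = int (csym ?\<beta> s (n + 1 - s))"
    using numer_factor[of s n ?\<beta>] s n by auto
  have "hilbert_fun ?V (trunc c I n) d = card {m \<in> avoid c a s n. mdeg m = d}" for d
    unfolding trunc_orbit_ideal[OF I last s]
    by (subst hilbert_fun_mono_ideal[OF up_closed_emb])
      (use not_emb_zero[of c a s n] last s in \<open>simp_all add: avoid_def monomials_def conj_ac\<close>)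
  then have "hilbert_series ?V (trunc c I n) = gf (avoid c a s n)"
    by (simp add: hilbert_series_def gf_def)
  then have "hilbert_series ?V (trunc c I n) * (1 - fps_X) ^ (c * n) = fps_of_poly (numer ?\<beta> s n)"
    by (simp only: gf_avoid)
  also have "\<dots> = (1 - fps_X) ^ (n + 1 - s) * fps_of_poly Q"
    unfolding Q(1) fps_of_poly_mult fps_of_poly_power fps_of_poly_diff by simp
  finally have "hilbert_series ?V (trunc c I n) * (1 - fps_X) ^ (c * n) =
      (1 - fps_X) ^ (n + 1 - s) * fps_of_poly Q" .
  \<comment> \<open>The denominator has at least n + 1 - s factors 1 - t, so these can be cancelled;
    the exponent (c - 1) n + s - 1 remains.\<close>
  moreover have "n \<le> c * n" using c by simp
  then have "c * n = (n + 1 - s) + (c * n - (n + 1 - s))" using s by linarith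
  then have "(1 - fps_X :: int fps) ^ (c * n) = (1 - fps_X) ^ (n + 1 - s) * (1 - fps_X) ^ (c * n - (n + 1 - s))"
    by (metis power_add)
  ultimately have "(1 - fps_X) ^ (n + 1 - s) * (hilbert_series ?V (trunc c I n) * (1 - fps_X) ^ (c * n - (n + 1 - s))) =
      (1 - fps_X) ^ (n + 1 - s) * fps_of_poly Q"
    by (simp add: mult_ac)
  moreover have "(1 - fps_X :: int fps) \<noteq> 0"
    by (metis fps_X_neq_one right_minus_eq)
  ultimately have "hilbert_series ?V (trunc c I n) * (1 - fps_X) ^ (c * n - (n + 1 - s)) = fps_of_poly Q"
    by simp
  \<comment> \<open>The remaining fraction is reduced: its numerator is positive at 1, as the sum of
    the non-zero last column is.\<close>
  moreover have "csym ?\<beta> s (n + 1 - s) \<noteq> 0"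
  proof -
    obtain i where i: "i \<in> {1..c}" "a i s \<noteq> 0" using last by blast
    then have "?\<beta> s \<noteq> 0" by auto
    then have "0 < ?\<beta> s ^ (n + 1 - s)" by (simp only: zero_less_power neq0_conv)
    also have "\<dots> \<le> csym ?\<beta> s (n + 1 - s)" by (rule csym_ge) (use s in simp)
    finally show ?thesis by simp
  qed
  then have "poly Q 1 \<noteq> 0" by (simp add: Q(2))
  ultimately show ?thesis
    using ideal_deg_eqI Q(2) by metis
qed

section \<open>The limits of the normalized dimension and of the roots of the degree\<close>

theorem corollary3p8:
  fixes c r :: nat
    and \<mu> :: "nat \<Rightarrow> nat"
    and a :: "nat \<Rightarrow> nat \<Rightarrow> nat"
    and b :: "nat \<Rightarrow> nat"
    and I :: "'k::field pol set"
  assumes "1 \<le> c" and "1 \<le> r"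
    and "strict_mono_on {1..r} \<mu>"
    and "\<exists>i\<in>{1..c}. \<exists>j\<in>{1..\<mu> r}. a i j \<noteq> 0"
    and "{j \<in> {1..\<mu> r}. \<exists>i\<in>{1..c}. a i j \<noteq> 0} = \<mu> ` {1..r}"
    and "I = orbit_ideal c (\<Prod>i=1..c. \<Prod>j=1..\<mu> r. var i j ^ a i j)"
    and "\<forall>j\<in>{1..r}. b j = (\<Sum>i=1..c. a i (\<mu> j))"
  shows "((\<lambda>n. ereal_of_enat (krull_dim (KXn c n Quot trunc c I n)) / ereal (real n))
           \<longlonglongrightarrow> ereal (real c - 1)) \<and>
         ((\<lambda>n. root n (real_of_int (ideal_deg ({1..c} \<times> {1..n}) (trunc c I n))))
           \<longlonglongrightarrow> real (Max (b ` {1..r})))"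
proof
  let ?s = "\<mu> r" and ?\<beta> = "\<lambda>j. \<Sum>i=1..c. a i j"
  \<comment> \<open>The index r itself belongs to \<open>{1..r}\<close>, so the last of the columns
    considered is a non-zero one.\<close>
  have "\<mu> r \<in> {j \<in> {1..\<mu> r}. \<exists>i\<in>{1..c}. a i j \<noteq> 0}"
    using assms(2,5) by auto
  then have s: "1 \<le> ?s" and last: "\<exists>i\<in>{1..c}. a i ?s \<noteq> 0" by auto
  note bounds = krull_dim_trunc_bounds[OF assms(1,6) last s]
  show "(\<lambda>n. ereal_of_enat (krull_dim (KXn c n Quot trunc c I n)) / ereal (real n)) \<longlonglongrightarrow> ereal (real c - 1)"
  \<comment> \<open>The comparison is made in the extended reals, since \<open>krull_dim\<close> has
    values in \<open>enat\<close>. The bounds are divided by n from n = 1 on.\<close>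
  proof (rule tendsto_sandwich)
    show "\<forall>\<^sub>F n in sequentially. ereal (real c - 1) \<le>
        ereal_of_enat (krull_dim (KXn c n Quot trunc c I n)) / ereal (real n)"
      using eventually_ge_at_top[of 1]
    proof eventually_elim
      case (elim n)
      have "ereal_of_enat (enat ((c - 1) * n)) \<le> ereal_of_enat (krull_dim (KXn c n Quot trunc c I n))"
        using bounds(1)[of n] by (simp only: ereal_of_enat_le_iff)
      then have "ereal (real ((c - 1) * n)) / ereal (real n) \<le>
          ereal_of_enat (krull_dim (KXn c n Quot trunc c I n)) / ereal (real n)"
        using elim by (intro ereal_divide_right_mono) auto
      moreover have "ereal (real ((c - 1) * n)) / ereal (real n) = ereal (real c - 1)"
        using elim assms(1) by (simp add: of_nat_diff)
      ultimately show ?case by simp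
    qed
    show "\<forall>\<^sub>F n in sequentially. ereal_of_enat (krull_dim (KXn c n Quot trunc c I n)) / ereal (real n) \<le>
        ereal (real c - 1 + real ?s / real n)"
      using eventually_ge_at_top[of 1]
    proof eventually_elim
      case (elim n)
      have "ereal_of_enat (krull_dim (KXn c n Quot trunc c I n)) \<le> ereal_of_enat (enat ((c - 1) * n + ?s))"
        using bounds(2)[of n] by (simp only: ereal_of_enat_le_iff)
      then have "ereal_of_enat (krull_dim (KXn c n Quot trunc c I n)) / ereal (real n) \<le>
          ereal (real ((c - 1) * n + ?s)) / ereal (real n)"
        using elim by (intro ereal_divide_right_mono) auto
      moreover have "ereal (real ((c - 1) * n + ?s)) / ereal (real n) = ereal (real c - 1 + real ?s / real n)"
        using elim assms(1) by (simp add: of_nat_diff add_divide_distrib)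
      ultimately show ?case by simp
    qed
    have "(\<lambda>n. real c - 1 + real ?s / real n) \<longlonglongrightarrow> real c - 1 + 0"
      by (intro tendsto_intros lim_const_over_n)
    then show "(\<lambda>n. ereal (real c - 1 + real ?s / real n)) \<longlonglongrightarrow> ereal (real c - 1)" by simp
  qed simp
  let ?B = "Max (b ` {1..r})"
  have bB: "b j \<le> ?B" if "j \<in> {1..r}" for j using that by simp
  have "?B \<in> b ` {1..r}" using assms(2) by (intro Max_in) auto
  then obtain j where j: "j \<in> {1..r}" "?B = b j" by blast
  \<comment> \<open>The limit lemma ranges over all columns up to the last, including the gaps. A
    gap has column sum 0, and every other column sum is one of the \<open>b j\<close>.\<close>
  have le: "?\<beta> k \<le> ?B" if k: "k \<in> {1..?s}" for k
  proof (cases "\<exists>i\<in>{1..c}. a i k \<noteq> 0")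
    case True
    then have "k \<in> \<mu> ` {1..r}" using k assms(5) by blast
    then show ?thesis using assms(7) bB by auto
  qed simp
  have \<mu>: "\<mu> j \<in> {1..?s}" using j(1) assms(5) by blast
  have \<beta>: "?\<beta> (\<mu> j) = ?B" using assms(7) j by simp
  have "1 \<le> ?\<beta> ?s" using last by (auto simp: Suc_le_eq intro: gr0I)
  then have B: "1 \<le> ?B" using le[of ?s] s by simp
  have "(\<lambda>n. root n (real (csym ?\<beta> ?s (n + 1 - ?s)))) \<longlonglongrightarrow> real ?B"
    by (rule root_csym_limit[where \<beta> = ?\<beta> and p = ?s and B = ?B, OF le \<mu> \<beta> B])
  moreover have "\<forall>\<^sub>F n in sequentially. root n (real (csym ?\<beta> ?s (n + 1 - ?s))) =
      root n (real_of_int (ideal_deg ({1..c} \<times> {1..n}) (trunc c I n)))"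
    \<comment> \<open>The formula for the degree is available once n has reached the length of the
      word, which is enough for the limit.\<close>
    using eventually_ge_at_top[of ?s]
  proof eventually_elim
    case (elim n)
    show ?case
      by (simp only: ideal_deg_trunc[OF assms(1,6) last s elim] of_int_of_nat_eq)
  qed
  ultimately show "(\<lambda>n. root n (real_of_int (ideal_deg ({1..c} \<times> {1..n}) (trunc c I n)))) \<longlonglongrightarrow> real ?B"
    by (rule Lim_transform_eventually)
qed

end
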